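(* Let $b\ge 0$ and $c>0$ be real numbers, let $p$ be a positive integer, let $s>3/2$ and $T>0$, and assume that $u\in C^0([0,T),H^s(\mathbb{S}))$ is a solution of $$u_t-u_{txx}+(b+c)u^pu_{x}=bu^{p-1}u_{x}u_{xx}+cu^pu_{xxx}.$$ Suppose that one of the following holds: (i) $p=1$, $b\in[0,3c]$, and $s>3/2$; or (ii) $b=pc$, $p$ is odd, and $s>3/2$; or (iii) $b=pc$, $p$ is even, $m_0$ is either non-negative or non-positive, and $s=3$. If there exist $t^\ast\in(0,T)$ and $\alpha,\beta\in\mathbb{S}$, with $\alpha<\beta$, such that $u(t^\ast,\cdot)\big|_{[\alpha,\beta]}\equiv0$ and $u_t(t^\ast,\alpha)=u_t(t^\ast,\beta)=0$, then $u\equiv0$ on $[0,T)\times\mathbb{S}$.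
   Context: $\mathbb{S}$ is the circle, identified with $[0,1)$ (functions on $\mathbb{S}$ are $1$-periodic functions on $\mathbb{R}$); $H^s(\mathbb{S})$ is the Sobolev space of order $s$ on the circle. Here $m_0=u_0-u_0''$ with $u_0=u(0,\cdot)$. Solutions are assumed to be at least $C^1$ in $t$, with $u\in C^1([0,T),H^{s-1}(\mathbb{S}))$ (so $u_t$ is continuous in $x$); for low $s$ the equation is understood in the equivalent non-local form $$u_t+cu^pu_x=-\partial_x\Lambda^{-2}\Big(\tfrac{3pc-b}{2}u^{p-1}u_x^2+\tfrac{b}{p+1}u^{p+1}\Big)-\tfrac{(p-1)(b-pc)}{2}\Lambda^{-2}\big(u^{p-2}u_x^3\big),$$ where $\Lambda^{-2}=(1-\partial_x^2)^{-1}$ on the circle (the last term is absent when $p=1$ or $b=pc$). Local well-posedness in $H^s(\mathbb{S})$, $s>3/2$ (existence, uniqueness and continuous dependence on the initial data in $C^0([0,T),H^s(\mathbb{S}))\cap C^1([0,T),H^{s-1}(\mathbb{S}))$) is known. *)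

theory Defs
  imports "HOL-Analysis.Analysis"
begin

text \<open>
  The circle is $[0,1)$; functions on it are 1-periodic functions on the reals, expressed by the
  library predicate \<^const>\<open>periodic_fun_simple'\<close>.
\<close>

definition fourier_coeff :: "(real \<Rightarrow> real) \<Rightarrow> int \<Rightarrow> complex" where
  "fourier_coeff f k =
     (LINT x:{0..1}|lebesgue. complex_of_real (f x) * cis (- (2 * pi * of_int k * x)))"

text \<open>The weight is the symbol of $(1-\partial_x^2)^s$ on a circle of length 1.\<close>

definition sobolev_weight :: "real \<Rightarrow> int \<Rightarrow> real" where
  "sobolev_weight s k = (1 + (2 * pi * of_int k)\<^sup>2) powr s"

text \<open>
  Only orders $s \ge 0$ are covered, where every element is a square-integrable function.
  For periodic functions, membership depends only on the class modulo null sets.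
\<close>

definition sobolev :: "real \<Rightarrow> (real \<Rightarrow> real) set" where
  "sobolev s = {f. periodic_fun_simple' f \<and> f \<in> borel_measurable lebesgue \<and>
     set_integrable lebesgue {0..1} (\<lambda>x. (f x)\<^sup>2) \<and>
     (\<lambda>k. sobolev_weight s k * (cmod (fourier_coeff f k))\<^sup>2) summable_on UNIV}"

definition sobolev_norm :: "real \<Rightarrow> (real \<Rightarrow> real) \<Rightarrow> real" where
  "sobolev_norm s f = sqrt (\<Sum>\<^sub>\<infinity>k. sobolev_weight s k * (cmod (fourier_coeff f k))\<^sup>2)"

text \<open>Curves $t \mapsto u(t,\cdot)$ in $C^0([0,T),H^s)$, and $H^s$-valued derivatives of curves
  (one-sided at $t=0$).\<close>

definition C0_sobolev :: "real \<Rightarrow> real \<Rightarrow> (real \<Rightarrow> real \<Rightarrow> real) \<Rightarrow> bool" where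
  "C0_sobolev T s u \<longleftrightarrow> (\<forall>t\<in>{0..<T}. u t \<in> sobolev s) \<and>
     (\<forall>t\<in>{0..<T}. ((\<lambda>r. sobolev_norm s (\<lambda>x. u r x - u t x)) \<longlongrightarrow> 0) (at t within {0..<T}))"

definition has_sobolev_derivative ::
  "real \<Rightarrow> real \<Rightarrow> (real \<Rightarrow> real \<Rightarrow> real) \<Rightarrow> (real \<Rightarrow> real \<Rightarrow> real) \<Rightarrow> bool" where
  "has_sobolev_derivative T s u ut \<longleftrightarrow>
     (\<forall>t\<in>{0..<T}. ((\<lambda>r. sobolev_norm s (\<lambda>x. (u r x - u t x) / (r - t) - ut t x)) \<longlongrightarrow> 0)
        (at t within {0..<T}))"

definition helmholtz_solution :: "(real \<Rightarrow> real) \<Rightarrow> (real \<Rightarrow> real) \<Rightarrow> bool" where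
  "helmholtz_solution g v \<longleftrightarrow> periodic_fun_simple' v \<and>
     (\<exists>v' v''. (\<forall>x. (v has_real_derivative v' x) (at x)) \<and>
               (\<forall>x. (v' has_real_derivative v'' x) (at x)) \<and>
               (\<forall>x. v x - v'' x = g x))"

text \<open>Meaningful for continuous 1-periodic arguments, see \<open>helmholtz_solution_ex1\<close> below;
  it is only applied to such functions.\<close>

definition helmholtz_inverse :: "(real \<Rightarrow> real) \<Rightarrow> real \<Rightarrow> real" where
  "helmholtz_inverse g = (THE v. helmholtz_solution g v)"

lemma ode_hom:
  fixes d :: "real \<Rightarrow> real"
  assumes 1: "\<And>x. (d has_real_derivative d1 x) (at x)"
    and 2: "\<And>x. (d1 has_real_derivative d x) (at x)"
  obtains A B where "\<And>x. d x = A * exp x + B * exp (- x)"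
proof -
  have "((\<lambda>x. (d x + d1 x) * exp (- x)) has_real_derivative 0) (at x)" for x
    by (rule derivative_eq_intros 1 2 refl | simp add: algebra_simps)+
  then obtain a where a: "\<And>x. (d x + d1 x) * exp (- x) = a"
    using DERIV_isconst_all by blast
  have "((\<lambda>x. (d x - d1 x) * exp x) has_real_derivative 0) (at x)" for x
    by (rule derivative_eq_intros 1 2 refl | simp add: algebra_simps)+
  then obtain b where b: "\<And>x. (d x - d1 x) * exp x = b"
    using DERIV_isconst_all by blast
  have "d x = a / 2 * exp x + b / 2 * exp (- x)" for x
  proof -
    have "a * exp x = d x + d1 x" using a[of x] by (simp add: exp_minus field_simps)
    moreover have "b * exp (- x) = d x - d1 x" using b[of x] by (simp add: exp_minus field_simps)
    ultimately show ?thesis by (simp add: field_simps)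
  qed
  then show ?thesis using that by blast
qed

lemma ode_hom_periodic:
  fixes d :: "real \<Rightarrow> real"
  assumes 1: "\<And>x. (d has_real_derivative d1 x) (at x)"
    and 2: "\<And>x. (d1 has_real_derivative d x) (at x)"
    and per: "\<And>x. d (x + 1) = d x"
  shows "d x = 0"
proof -
  obtain A B where d: "\<And>x. d x = A * exp x + B * exp (- x)" using ode_hom[OF 1 2] by blast
  have "d1 x = A * exp x - B * exp (- x)" for x
  proof -
    have "d = (\<lambda>x. A * exp x + B * exp (- x))" using d by blast
    then have "(d has_real_derivative A * exp x - B * exp (- x)) (at x)"
      by (auto intro!: derivative_eq_intros)
    then show ?thesis using 1 DERIV_unique by blast
  qed
  note d1 = this
  have per1: "d1 (x + 1) = d1 x" for x
  proof -
    have "((\<lambda>x. d (x + 1)) has_real_derivative d1 (x + 1)) (at x)"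
      using DERIV_shift 1 by blast
    moreover have "(\<lambda>x. d (x + 1)) = d" using per by blast
    ultimately show ?thesis using 1 DERIV_unique by metis
  qed
  have "d 1 = d 0" "d1 1 = d1 0" using per[of 0] per1[of 0] by auto
  then have "A * exp 1 + B * exp (-1) = A + B" "A * exp 1 - B * exp (-1) = A - B"
    unfolding d d1 by auto
  then have "A * exp 1 = A" "B * exp (-1) = B" by linarith+
  then have "A = 0" "B = 0" by auto
  then show ?thesis using d by simp
qed

lemma helmholtz_solution_ex1:
  assumes cont: "continuous_on UNIV g" and per: "periodic_fun_simple' g"
  shows "\<exists>!v. helmholtz_solution g v"
proof (rule ex_ex1I)
  have antider: "\<exists>F. \<forall>x. (F has_real_derivative f x) (at x)"
    if "continuous_on UNIV f" for f :: "real \<Rightarrow> real"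
    using einterval_antiderivative[of "-\<infinity>" "\<infinity>" f] that
    by (auto simp: has_real_derivative_iff_has_vector_derivative continuous_on_eq_continuous_at)
  obtain P where P: "\<And>x. (P has_real_derivative exp (- x) * g x) (at x)"
  proof -
    have "continuous_on UNIV (\<lambda>x. exp (- x) * g x)" using cont by (intro continuous_intros)
    from antider[OF this] show ?thesis using that by blast
  qed
  obtain Q where Q: "\<And>x. (Q has_real_derivative exp x * g x) (at x)"
  proof -
    have "continuous_on UNIV (\<lambda>x. exp x * g x)" using cont by (intro continuous_intros)
    from antider[OF this] show ?thesis using that by blast
  qed
  define v where "v = (\<lambda>x. (exp (- x) * Q x - exp x * P x) / 2)"
  define v1 where "v1 = (\<lambda>x. (- exp (- x) * Q x - exp x * P x) / 2)"
  have v: "(v has_real_derivative v1 x) (at x)" for x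
    unfolding v_def v1_def
    by (rule derivative_eq_intros P Q refl | simp add: field_simps flip: exp_add)+
  have v1: "(v1 has_real_derivative v x - g x) (at x)" for x
    unfolding v_def v1_def
    by (rule derivative_eq_intros P Q refl | simp add: field_simps flip: exp_add)+
  have gper: "g (x + 1) = g x" for x using per by (simp add: periodic_fun_simple'_def)
  obtain A B where AB: "\<And>x. v (x + 1) - v x = A * exp x + B * exp (- x)"
  proof (rule ode_hom)
    fix x
    show "((\<lambda>x. v (x + 1) - v x) has_real_derivative v1 (x + 1) - v1 x) (at x)"
      using v DERIV_shift by (intro DERIV_diff) blast+
    have "((\<lambda>x. v1 (x + 1) - v1 x) has_real_derivative
            (v (x + 1) - g (x + 1)) - (v x - g x)) (at x)"
      using v1 DERIV_shift[of v1 _ x 1] by (intro DERIV_diff) blast+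
    then show "((\<lambda>x. v1 (x + 1) - v1 x) has_real_derivative v (x + 1) - v x) (at x)"
      using gper by simp
  qed blast
  define a where "a = - A / (exp 1 - 1)"
  define b where "b = - B / (exp (-1) - 1)"
  have ab: "a * exp 1 = a - A" "b * exp (- 1) = b - B"
    by (auto simp: a_def b_def divide_simps) (auto simp: algebra_simps)
  define w where "w = (\<lambda>x. v x + a * exp x + b * exp (- x))"
  have "helmholtz_solution g w"
    unfolding helmholtz_solution_def
  proof (intro conjI exI allI)
    show "periodic_fun_simple' w"
    proof
      fix x
      have "a * exp (x + 1) = (a * exp 1) * exp x"
        "b * exp (- (x + 1)) = (b * exp (- 1)) * exp (- x)"
        by (simp_all add: exp_add exp_diff exp_minus field_simps)
      then show "w (x + 1) = w x"
        using AB[of x] unfolding ab w_def by (simp add: algebra_simps)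
    qed
    fix x
    show "(w has_real_derivative v1 x + a * exp x - b * exp (- x)) (at x)"
      unfolding w_def by (rule derivative_eq_intros v refl | simp)+
    show "((\<lambda>x. v1 x + a * exp x - b * exp (- x)) has_real_derivative w x - g x) (at x)"
      unfolding w_def by (rule derivative_eq_intros v1 refl | simp)+
    show "w x - (w x - g x) = g x" by simp
  qed
  then show "\<exists>v. helmholtz_solution g v" by blast
next
  fix v w assume "helmholtz_solution g v" "helmholtz_solution g w"
  then obtain v1 v2 w1 w2 where
    per: "\<And>x. v (x + 1) = v x" "\<And>x. w (x + 1) = w x" and
    v: "\<And>x. (v has_real_derivative v1 x) (at x)" "\<And>x. (v1 has_real_derivative v2 x) (at x)"
      "\<And>x. v x - v2 x = g x" and
    w: "\<And>x. (w has_real_derivative w1 x) (at x)" "\<And>x. (w1 has_real_derivative w2 x) (at x)"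
      "\<And>x. w x - w2 x = g x"
    unfolding helmholtz_solution_def periodic_fun_simple'_def by blast
  show "v = w"
  proof
    fix x
    have "((\<lambda>x. v1 x - w1 x) has_real_derivative v x - w x) (at x)" for x
    proof -
      have "v x - w x = v2 x - w2 x" using v(3)[of x] w(3)[of x] by linarith
      then show ?thesis using DERIV_diff[OF v(2) w(2)] by metis
    qed
    from ode_hom_periodic[OF DERIV_diff[OF v(1) w(1)] this, of x] per
    show "v x = w x" by simp
  qed
qed

lemma helmholtz_inverse:
  assumes "continuous_on UNIV g" "periodic_fun_simple' g"
  shows "helmholtz_solution g (helmholtz_inverse g)"
  unfolding helmholtz_inverse_def using helmholtz_solution_ex1[OF assms] by (rule theI')

text \<open>
  Both forms are stated at a fixed time, with \<open>v\<close> for $u(t,\cdot)$ and \<open>w\<close> for $u_t(t,\cdot)$.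
\<close>

definition local_form :: "real \<Rightarrow> real \<Rightarrow> nat \<Rightarrow> (real \<Rightarrow> real) \<Rightarrow> (real \<Rightarrow> real) \<Rightarrow> bool" where
  "local_form b c p v w \<longleftrightarrow> (\<forall>x.
     w x - (deriv ^^ 2) w x + (b + c) * v x ^ p * deriv v x =
     b * v x ^ (p - 1) * deriv v x * (deriv ^^ 2) v x + c * v x ^ p * (deriv ^^ 3) v x)"

text \<open>For $p = 1$ the exponent $p - 2$ below is truncated, but its term has coefficient zero.\<close>

definition nonlocal_form :: "real \<Rightarrow> real \<Rightarrow> nat \<Rightarrow> (real \<Rightarrow> real) \<Rightarrow> (real \<Rightarrow> real) \<Rightarrow> bool" where
  "nonlocal_form b c p v w \<longleftrightarrow> (\<forall>x.
     w x + c * v x ^ p * deriv v x =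
     - deriv (helmholtz_inverse (\<lambda>y. (3 * real p * c - b) / 2 * v y ^ (p - 1) * (deriv v y)\<^sup>2
                                    + b / (real p + 1) * v y ^ (p + 1))) x
     - (real p - 1) * (b - real p * c) / 2
         * helmholtz_inverse (\<lambda>y. v y ^ (p - 2) * (deriv v y) ^ 3) x)"

text \<open>The two forms agree for functions that are regular enough for the local form to make
  classical sense.\<close>

lemma local_form_iff_nonlocal_form:
  fixes v w :: "real \<Rightarrow> real"
  assumes p: "p > 0" and per: "periodic_fun_simple' v" "periodic_fun_simple' w"
    and v: "\<And>x. (v has_real_derivative v1 x) (at x)" "\<And>x. (v1 has_real_derivative v2 x) (at x)"
      "\<And>x. (v2 has_real_derivative v3 x) (at x)"
    and w: "\<And>x. (w has_real_derivative w1 x) (at x)" "\<And>x. (w1 has_real_derivative w2 x) (at x)"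
  shows "local_form b c p v w \<longleftrightarrow> nonlocal_form b c p v w"
proof -
  have deriv_eq: "deriv f = f'" if "\<And>x. (f has_real_derivative f' x) (at x)"
    for f f' :: "real \<Rightarrow> real"
    using that DERIV_imp_deriv by blast
  note dv = deriv_eq[OF v(1)] deriv_eq[OF v(2)] deriv_eq[OF v(3)] deriv_eq[OF w(1)] deriv_eq[OF w(2)]
  have shift: "f' (x + 1) = f' x"
    if "\<And>x. (f has_real_derivative f' x) (at x)" "\<And>x. f (x + 1) = f x"
    for f f' :: "real \<Rightarrow> real" and x
  proof -
    have "((\<lambda>x. f (x + 1)) has_real_derivative f' (x + 1)) (at x)"
      using DERIV_shift that(1) by blast
    moreover have "(\<lambda>x. f (x + 1)) = f" using that(2) by blast
    ultimately show ?thesis using that(1) DERIV_unique by metis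
  qed
  have pv: "v (x + 1) = v x" and pw: "w (x + 1) = w x" for x
    using per by (auto simp: periodic_fun_simple'_def)
  note pv1 = shift[OF v(1) pv]
  have cv: "continuous_on UNIV v" "continuous_on UNIV v1"
    using DERIV_continuous_on[of UNIV v v1] DERIV_continuous_on[of UNIV v1 v2] v by auto
  obtain q where q: "p = Suc q" using p by (cases p) auto
  define F where "F = (\<lambda>y. (3 * real p * c - b) / 2 * v y ^ (p - 1) * (v1 y)\<^sup>2
                                    + b / (real p + 1) * v y ^ (p + 1))"
  define G where "G = (\<lambda>y. v y ^ (p - 2) * (v1 y) ^ 3)"
  define C where "C = (real p - 1) * (b - real p * c) / 2"
  define F1 where "F1 = (\<lambda>y. (3 * real p * c - b) / 2 *
      ((real p - 1) * v y ^ (p - 2) * v1 y ^ 3 + 2 * v y ^ (p - 1) * v1 y * v2 y) + b * v y ^ p * v1 y)"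
  have F: "(F has_real_derivative F1 x) (at x)" for x
    unfolding F_def F1_def q
    apply (rule derivative_eq_intros v refl)+
    apply (simp add: field_simps power2_eq_square power3_eq_cube)
    done
  have "helmholtz_solution F (helmholtz_inverse F)"
  proof (rule helmholtz_inverse)
    show "continuous_on UNIV F" unfolding F_def by (intro continuous_intros cv)
    show "periodic_fun_simple' F" by unfold_locales (simp add: F_def pv pv1)
  qed
  then obtain V V1 V2 where V: "helmholtz_inverse F = V" "\<And>x. V (x + 1) = V x"
    "\<And>x. (V has_real_derivative V1 x) (at x)" "\<And>x. (V1 has_real_derivative V2 x) (at x)"
    "\<And>x. V x - V2 x = F x"
    unfolding helmholtz_solution_def periodic_fun_simple'_def by blast
  have V2: "V2 = (\<lambda>x. V x - F x)" proof
    show "V2 x = V x - F x" for x using V(5)[of x] by linarith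
  qed
  have V3: "(V2 has_real_derivative V1 x - F1 x) (at x)" for x
    unfolding V2 by (intro DERIV_diff V F)
  have "helmholtz_solution G (helmholtz_inverse G)"
  proof (rule helmholtz_inverse)
    show "continuous_on UNIV G" unfolding G_def by (intro continuous_intros cv)
    show "periodic_fun_simple' G" by unfold_locales (simp add: G_def pv pv1)
  qed
  then obtain W W1 W2 where W: "helmholtz_inverse G = W" "\<And>x. W (x + 1) = W x"
    "\<And>x. (W has_real_derivative W1 x) (at x)" "\<And>x. (W1 has_real_derivative W2 x) (at x)"
    "\<And>x. W x - W2 x = G x"
    unfolding helmholtz_solution_def periodic_fun_simple'_def by blast
  define d where "d = (\<lambda>x. w x + c * v x ^ p * v1 x + V1 x + C * W x)"
  define d1 where "d1 = (\<lambda>x. w1 x + c * (real p * v x ^ (p - 1) * (v1 x)\<^sup>2 + v x ^ p * v2 x)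
     + V2 x + C * W1 x)"
  define d2 where "d2 = (\<lambda>x. w2 x + c * (real p * (real p - 1) * v x ^ (p - 2) * v1 x ^ 3
     + 3 * real p * v x ^ (p - 1) * v1 x * v2 x + v x ^ p * v3 x)
     + (V1 x - F1 x) + C * W2 x)"
  have d: "(d has_real_derivative d1 x) (at x)" for x
    unfolding d_def d1_def q
    apply (rule derivative_eq_intros v w V W refl)+
    apply (simp add: field_simps power2_eq_square)
    done
  have d1: "(d1 has_real_derivative d2 x) (at x)" for x
    unfolding d1_def d2_def q
    apply (rule derivative_eq_intros v w V3 W refl)+
    apply (simp add: field_simps power2_eq_square power3_eq_cube)
    done
  have dper: "d (x + 1) = d x" for x
    by (simp add: d_def pv pw pv1 W shift[OF V(3) V(2)])
  have nonloc: "nonlocal_form b c p v w \<longleftrightarrow> (\<forall>x. d x = 0)"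
  proof -
    have "nonlocal_form b c p v w \<longleftrightarrow> (\<forall>x. w x + c * v x ^ p * v1 x = - V1 x - C * W x)"
      unfolding nonlocal_form_def dv(1)
      by (simp only: F_def[symmetric] G_def[symmetric] C_def[symmetric] V(1) W(1) deriv_eq[OF V(3)])
    also have "\<dots> \<longleftrightarrow> (\<forall>x. d x = 0)"
    proof (rule arg_cong[where f = All], rule ext)
      show "(w x + c * v x ^ p * v1 x = - V1 x - C * W x) = (d x = 0)" for x
        unfolding d_def by linarith
    qed
    finally show ?thesis .
  qed
  have key: "d x - d2 x = w x - w2 x + (b + c) * v x ^ p * v1 x
      - (b * v x ^ (p - 1) * v1 x * v2 x + c * v x ^ p * v3 x)" for x
  proof -
    have "d x - d2 x = w x - w2 x + c * v x ^ p * v1 x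
      - c * (real p * (real p - 1) * v x ^ (p - 2) * v1 x ^ 3
        + 3 * real p * v x ^ (p - 1) * v1 x * v2 x + v x ^ p * v3 x) + F1 x + C * (W x - W2 x)"
      unfolding d_def d2_def by (simp add: algebra_simps)
    then show ?thesis
      unfolding W(5) F1_def C_def G_def by (simp add: field_simps)
  qed
  have loc: "local_form b c p v w \<longleftrightarrow> (\<forall>x. d2 x = d x)"
  proof -
    have "local_form b c p v w \<longleftrightarrow> (\<forall>x. w x - w2 x + (b + c) * v x ^ p * v1 x =
       b * v x ^ (p - 1) * v1 x * v2 x + c * v x ^ p * v3 x)"
      unfolding local_form_def by (simp add: numeral_2_eq_2 numeral_3_eq_3 dv)
    also have "\<dots> \<longleftrightarrow> (\<forall>x. d x - d2 x = 0)" unfolding key by simp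
    finally show ?thesis by (metis eq_iff_diff_eq_0)
  qed
  show ?thesis
    unfolding nonloc loc
  proof
    assume "\<forall>x. d2 x = d x"
    then have "\<And>x. (d1 has_real_derivative d x) (at x)" using d1 by metis
    then show "\<forall>x. d x = 0" using ode_hom_periodic[OF d _ dper] by blast
  next
    assume z: "\<forall>x. d x = 0"
    then have d0: "d = (\<lambda>x. 0)" by blast
    have "d1 x = 0" for x using d[of x] DERIV_unique[OF _ DERIV_const] unfolding d0 by blast
    then have d10: "d1 = (\<lambda>x. 0)" by blast
    have "d2 x = 0" for x using d1[of x] DERIV_unique[OF _ DERIV_const] unfolding d10 by blast
    then show "\<forall>x. d2 x = d x" using z by simp
  qed
qed

text \<open>
  A solution in $C^0([0,T),H^s) \cap C^1([0,T),H^{s-1})$, $s > 3/2$. Elements of $H^s$ and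
  $H^{s-1}$ are represented by their continuous representatives, which exist since
  $s - 1 > 1/2$; then \<open>u t\<close> is continuously differentiable in the space variable and \<open>ut t x\<close> is
  the pointwise time derivative of \<open>u\<close>. For $s > 7/2$ all derivatives in the equation are
  continuous functions and the local form is understood classically; for lower $s$ the
  equation means its non-local form.
\<close>

definition is_solution ::
  "real \<Rightarrow> real \<Rightarrow> nat \<Rightarrow> real \<Rightarrow> real \<Rightarrow> (real \<Rightarrow> real \<Rightarrow> real) \<Rightarrow> bool" where
  "is_solution b c p s T u \<longleftrightarrow>
     C0_sobolev T s u \<and> (\<forall>t\<in>{0..<T}. continuous_on UNIV (u t)) \<and>
     (\<exists>ut. C0_sobolev T (s - 1) ut \<and> (\<forall>t\<in>{0..<T}. continuous_on UNIV (ut t)) \<and>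
        has_sobolev_derivative T (s - 1) u ut \<and>
        (\<forall>t\<in>{0..<T}. if s > 7/2 then local_form b c p (u t) (ut t)
                       else nonlocal_form b c p (u t) (ut t)))"

definition momentum :: "(real \<Rightarrow> real) \<Rightarrow> real \<Rightarrow> real" where
  "momentum v x = v x - (deriv ^^ 2) v x"

end

theory Submission
  imports Defs "HOL-Library.Nat_Bijection"
begin

text \<open>
  At time $t^*$ write $G = \Lambda^{-2}F$, so $u_t + c u^p u_x = -G'$; the term with $u^{p-2}u_x^3$ drops out in all
  three cases, and $F$ has a sign: obviously for $p = 1$ and for odd $p$, and in case (iii) because
  $m_t + c (u^p m)_x = 0$ preserves the sign of $m = u - u_{xx}$, hence of $u$. The hypotheses on
  $[\alpha, \beta]$ say $F = 0$, i.e. $G'' = G$, there and $G'(\alpha) = G'(\beta) = 0$. As $G$ has a sign,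
  $G = G' = 0$ on the interval, and since $(G + G')e^{-x}$ is monotone and zero along a period, $F = 0$
  everywhere, so $u(t^*, \cdot) = 0$. That a solution vanishing at one time vanishes at all
  times, earlier ones included, follows from a $W^{1,\infty}$ estimate: near such a time a bound $M \le 1$ on
  $u$ and $u_x$ improves to $M/2$. Both this estimate and the sign of $m$ come from one maximum
  principle for transport equations in doubled variables. The regularity needed for classical
  arguments is supplied by the Sobolev embedding, proved by Fourier series.
\<close>

section \<open>Fourier series of continuous periodic functions\<close>

text \<open>The obstacle is low regularity. For s just above 3/2 only u, u_x and u_t are continuous,
  so the equation cannot be differentiated in x to get an evolution law for u_x; for s = 3 the
  momentum is continuous but has no classical time derivative. Hence neither quantity is followed
  directly. A statement about f_x is recast as one about the increments f(t,y) - f(t,x), where f is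
  u or u_x minus a primitive of u, up to sign, and f obeys a first-order equation that holds
  pointwise. The parameter ranges enter through the coefficients A = (3pc - b)/2 and B = b/(p+1) of
  F: in all three cases they are non-negative and never both zero, so F = 0 is strong enough to
  force u = 0 once u vanishes on an interval.\<close>

definition wave :: "int \<Rightarrow> real \<Rightarrow> complex" where
  "wave k x = cis (2 * pi * of_int k * x)"

lemma norm_wave [simp]: "norm (wave k x) = 1"
  by (simp add: wave_def)

lemma cnj_wave: "cnj (wave k x) = wave (- k) x"
  by (simp add: wave_def cis_cnj)

lemma wave_mult: "wave j x * wave k x = wave (j + k) x"
  by (simp add: wave_def cis_mult ring_distribs)

lemma continuous_on_wave [continuous_intros]: "continuous_on S (wave k)"
  unfolding wave_def by (intro continuous_intros)

lemma wave_has_vector_derivative: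
  "(wave k has_vector_derivative (2 * pi * of_int k * \<i>) * wave k x) (at x within S)"
  unfolding wave_def has_vector_derivative_def
  by (auto intro!: derivative_eq_intros ext simp: scaleR_conv_of_real)

lemma has_integral_wave: "(wave k has_integral (if k = 0 then 1 else 0)) {0..1}"
proof (cases "k = 0")
  case True
  then show ?thesis using has_integral_const_real[of "1::complex" 0 1] by (simp add: wave_def[abs_def])
next
  case False
  have "((\<lambda>x. wave k x / (2 * pi * of_int k * \<i>)) has_vector_derivative wave k x) (at x within {0..1})" for x
    using has_vector_derivative_divide[OF wave_has_vector_derivative, of k "2 * pi * of_int k * \<i>" x "{0..1}"] False
    by simp
  from fundamental_theorem_of_calculus[OF zero_le_one this] False show ?thesis
    by (simp add: wave_def[abs_def])
qed

text \<open>Introduced inductively so that closure under products and the vanishing of integrals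
  against all of them both follow by induction from the single waves.\<close>

inductive trig_poly :: "(real \<Rightarrow> complex) \<Rightarrow> bool" where
  wave: "trig_poly (wave k)"
| scale: "trig_poly f \<Longrightarrow> trig_poly (\<lambda>x. c * f x)"
| add: "trig_poly f \<Longrightarrow> trig_poly g \<Longrightarrow> trig_poly (\<lambda>x. f x + g x)"

lemma trig_poly_const: "trig_poly (\<lambda>x. c)"
  using trig_poly.scale[OF trig_poly.wave[of 0], of c] by (simp add: wave_def)

lemma trig_poly_mult:
  assumes "trig_poly f" "trig_poly g"
  shows "trig_poly (\<lambda>x. f x * g x)"
proof -
  have w: "trig_poly (\<lambda>x. wave k x * g x)" for k
    using assms(2)
  proof induction
    case (wave j)
    then show ?case by (simp add: wave_mult trig_poly.wave)
  next
    case (scale f c)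
    then show ?case using trig_poly.scale[of _ c] by (simp add: mult.left_commute)
  next
    case (add f g)
    then show ?case by (simp add: ring_distribs trig_poly.add)
  qed
  show ?thesis
    using assms(1)
  proof induction
    case (wave k) then show ?case by (rule w)
  next
    case (scale f c)
    then show ?case using trig_poly.scale[of _ c] by (simp add: mult.assoc)
  next
    case (add f g)
    then show ?case by (simp add: ring_distribs trig_poly.add)
  qed
qed

text \<open>Bridge from polynomials in the plane, as Stone-Weierstrass supplies them, to Fourier
  modes. A real-linear functional on the unit circle is a cosine plus a sine, hence a combination of
  \<open>wave 1\<close> and \<open>wave (-1)\<close>.\<close>

lemma trig_poly_real_polynomial:
  assumes "real_polynomial_function (g :: complex \<Rightarrow> real)"
  shows "trig_poly (\<lambda>x. of_real (g (wave 1 x)))"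
  using assms
proof induction
  case (linear l)
  interpret l: bounded_linear l by fact
  have "of_real (l (wave 1 x)) = ((of_real (l 1) - \<i> * of_real (l \<i>)) / 2) * wave 1 x
     + ((of_real (l 1) + \<i> * of_real (l \<i>)) / 2) * wave (-1) x" for x
  proof -
    have "wave 1 x = cos (2*pi*x) *\<^sub>R 1 + sin (2*pi*x) *\<^sub>R \<i>"
      by (simp add: wave_def complex_eq_iff)
    then have "l (wave 1 x) = cos (2*pi*x) * l 1 + sin (2*pi*x) * l \<i>"
      by (simp only: l.add l.scaleR real_scaleR_def)
    then show ?thesis by (simp add: wave_def complex_eq_iff field_simps)
  qed
  then show ?case
    by (simp only:) (intro trig_poly.intros)
qed (auto intro: trig_poly_const trig_poly.add trig_poly_mult)

lemma continuous_on_trig_poly: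
  assumes "trig_poly f" shows "continuous_on S f"
  using assms by induction (auto intro!: continuous_intros)

lemma wave_1_eq_imp:
  assumes "wave 1 x = wave 1 y" obtains n where "x = y + of_int n"
proof -
  have "exp (\<i> * of_real (2*pi*x)) = exp (\<i> * of_real (2*pi*y))"
    using assms by (simp add: wave_def cis_conv_exp)
  then obtain n where "\<i> * of_real (2*pi*x) = \<i> * of_real (2*pi*y) + of_int (2 * n) * pi * \<i>"
    unfolding exp_eq by blast
  then have "2*pi*x = 2*pi*y + 2 * n * pi" by (simp add: complex_eq_iff)
  then have "pi * x = pi * (y + n)" by (simp add: algebra_simps)
  then show ?thesis using that[of n] by simp
qed

text \<open>\<open>g\<close> is defined through \<open>Arg\<close>, which jumps across the
  non-positive axis. There the same \<open>g\<close> is written with \<open>Arg2pi\<close>, whose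
  jump lies on the opposite half-axis; periodicity of \<open>d\<close> makes the two angles
  interchangeable.\<close>

lemma periodic_factors_through_circle:
  fixes d :: "real \<Rightarrow> real"
  assumes cont: "continuous_on UNIV d" and per: "periodic_fun_simple' d"
  obtains g where "continuous_on (sphere 0 1) g" "\<And>x. g (wave 1 x) = d x"
proof
  interpret periodic_fun_simple' d by fact
  define g where "g z = d (Arg z / (2 * pi))" for z
  show g: "g (wave 1 x) = d x" for x
  proof -
    have "wave 1 (Arg (wave 1 x) / (2 * pi)) = wave 1 x"
      using cis_Arg[of "wave 1 x"] by (simp add: wave_def sgn_cis)
    then obtain n where "Arg (wave 1 x) / (2 * pi) = x + of_int n" by (rule wave_1_eq_imp)
    then show ?thesis by (simp add: g_def plus_of_int)
  qed
  have cd: "isCont d x" for x using cont by (simp add: continuous_on_eq_continuous_at)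
  have g2: "g z = d (Arg2pi z / (2 * pi))" if "z \<noteq> 0" for z
  proof -
    have "wave 1 (Arg2pi z / (2 * pi)) = sgn z"
      using Arg2pi_eq[of z] that by (simp add: wave_def cis_conv_exp sgn_eq) (metis nonzero_mult_div_cancel_left norm_eq_zero of_real_eq_0_iff)
    moreover have "g (sgn z) = g z"
      unfolding g_def by (simp add: sgn_div_norm that scaleR_conv_of_real flip: of_real_inverse)
    ultimately show ?thesis using g by metis
  qed
  have "isCont g z" if "z \<noteq> 0" for z
  proof (cases "z \<in> \<real>\<^sub>\<le>\<^sub>0")
    case False
    have "isCont (\<lambda>z. d (Arg z / (2 * pi))) z"
      by (intro isCont_o2[OF _ cd] continuous_intros continuous_at_Arg False) auto
    then show ?thesis by (simp add: g_def[abs_def])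
  next
    case True
    then have "z \<notin> \<real>\<^sub>\<ge>\<^sub>0" using that by (auto simp: complex_nonpos_Reals_iff complex_nonneg_Reals_iff complex_eq_iff)
    then have "isCont (\<lambda>z. d (Arg2pi z / (2 * pi))) z"
      by (intro isCont_o2[OF _ cd] continuous_intros continuous_at_Arg2pi) auto
    moreover have "\<forall>\<^sub>F y in nhds z. g y = d (Arg2pi y / (2 * pi))"
      using t1_space_nhds[OF that] by (rule eventually_mono) (rule g2)
    ultimately show ?thesis using isCont_cong by fastforce
  qed
  then show "continuous_on (sphere 0 1) g"
    by (intro continuous_at_imp_continuous_on ballI) (metis mem_sphere_0 norm_zero zero_neq_one)
qed

lemma integral_trig_poly_eq_0:
  assumes cont: "continuous_on UNIV d"
    and orth: "\<And>k. integral {0..1} (\<lambda>x. of_real (d x) * wave k x) = 0"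
    and p: "trig_poly p"
  shows "integral {0..1} (\<lambda>x. of_real (d x) * p x) = 0"
  using p
proof induction
  case (wave k) then show ?case by (rule orth)
next
  case (scale f c)
  have "(\<lambda>x. of_real (d x) * (c * f x)) = (\<lambda>x. c * (of_real (d x) * f x))" by (simp add: ac_simps)
  then show ?case using scale by simp
next
  case (add f g)
  have "(\<lambda>x. of_real (d x) * h x) integrable_on {0..1}" if "trig_poly h" for h
    by (intro integrable_continuous_real continuous_intros continuous_on_trig_poly[OF that]
         continuous_on_subset[OF cont]) auto
  then show ?case using add by (simp add: ring_distribs integral_add)
qed

text \<open>Density argument: if \<open>p\<close> is a trigonometric polynomial within \<epsilon> of
  \<open>d\<close>, orthogonality turns the integral of \<open>d\<close> squared into that of
  \<open>d * (d - p)\<close>, which is at most \<epsilon> times the integral of |d|.\<close>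

lemma periodic_orthogonal_waves_eq_0:
  fixes d :: "real \<Rightarrow> real"
  assumes cont: "continuous_on UNIV d" and per: "periodic_fun_simple' d"
    and orth: "\<And>k. integral {0..1} (\<lambda>x. of_real (d x) * wave k x) = 0"
  shows "d x = 0"
proof -
  interpret periodic_fun_simple' d by fact
  obtain g where g: "continuous_on (sphere 0 1) g" "\<And>x. g (wave 1 x) = d x"
    using periodic_factors_through_circle[OF cont per] by blast
  have c01: "continuous_on {0..1} d" by (rule continuous_on_subset[OF cont]) auto
  define B where "B = integral {0..1} (\<lambda>x. \<bar>d x\<bar>)"
  have "integral {0..1} (\<lambda>x. (d x)\<^sup>2) \<le> 0"
  proof (rule field_le_epsilon)
    fix e :: real assume e: "e > 0"
    have "B \<ge> 0" unfolding B_def by (intro integral_nonneg integrable_continuous_real continuous_intros c01) auto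
    define \<epsilon> where "\<epsilon> = e / (B + 1)"
    have \<epsilon>: "\<epsilon> > 0" "\<epsilon> * B \<le> e" using e \<open>B \<ge> 0\<close> by (auto simp: \<epsilon>_def field_simps)
    obtain q where q: "real_polynomial_function q" "\<And>z. z \<in> sphere 0 1 \<Longrightarrow> \<bar>g z - q z\<bar> < \<epsilon>"
      using Stone_Weierstrass_real_polynomial_function[OF compact_sphere g(1) \<epsilon>(1)] by blast
    define p where "p x = q (wave 1 x)" for x
    have dp: "\<bar>d x - p x\<bar> < \<epsilon>" for x using q(2)[of "wave 1 x"] g(2) by (simp add: p_def)
    have tp: "trig_poly (\<lambda>x. of_real (p x))" unfolding p_def by (rule trig_poly_real_polynomial[OF q(1)])
    have cp: "continuous_on {0..1} p"
      using continuous_on_Re[OF continuous_on_trig_poly[OF tp, of "{0..1}"]] by simp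
    have i1: "(\<lambda>x. d x * p x) integrable_on {0..1}"
      by (intro integrable_continuous_real continuous_intros c01 cp)
    have "of_real (integral {0..1} (\<lambda>x. d x * p x)) = integral {0..1} (\<lambda>x. complex_of_real (d x * p x))"
      using integral_linear[OF i1 bounded_linear_of_real, symmetric] unfolding o_def .
    also have "\<dots> = 0"
      using integral_trig_poly_eq_0[OF cont orth tp] by simp
    finally have dp0: "integral {0..1} (\<lambda>x. d x * p x) = 0" by simp
    have "integral {0..1} (\<lambda>x. (d x)\<^sup>2) = integral {0..1} (\<lambda>x. (d x)\<^sup>2) - integral {0..1} (\<lambda>x. d x * p x)"
      using dp0 by simp
    also have "\<dots> = integral {0..1} (\<lambda>x. (d x)\<^sup>2 - d x * p x)"
      by (intro integral_diff[symmetric] i1 integrable_continuous_real continuous_intros c01)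
    also have "\<dots> \<le> integral {0..1} (\<lambda>x. \<epsilon> * \<bar>d x\<bar>)"
    proof (intro integral_le integrable_continuous_real continuous_intros c01 cp)
      fix x
      have "(d x)\<^sup>2 - d x * p x \<le> \<bar>d x\<bar> * \<bar>d x - p x\<bar>"
        by (simp add: power2_eq_square flip: right_diff_distrib abs_mult)
      also have "\<dots> \<le> \<bar>d x\<bar> * \<epsilon>" using dp[of x] by (intro mult_left_mono) auto
      finally show "(d x)\<^sup>2 - d x * p x \<le> \<epsilon> * \<bar>d x\<bar>" by (simp add: mult.commute)
    qed
    also have "\<dots> = \<epsilon> * B" by (simp add: B_def)
    finally show "integral {0..1} (\<lambda>x. (d x)\<^sup>2) \<le> 0 + e" using \<epsilon> by simp
  qed
  moreover have "integral {0..1} (\<lambda>x. (d x)\<^sup>2) \<ge> 0"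
    by (intro integral_nonneg integrable_continuous_real continuous_intros c01) auto
  ultimately have "integral {0..1} (\<lambda>x. (d x)\<^sup>2) = 0" by linarith
  then have z: "\<forall>x\<in>{0..1}. (d x)\<^sup>2 = 0"
    by (subst (asm) integral_eq_0_iff) (auto intro!: continuous_intros c01)
  have "d x = d (frac x)" using plus_of_int[of "frac x" "\<lfloor>x\<rfloor>"] by (simp add: frac_def)
  moreover have "frac x \<in> {0..1}" using frac_lt_1[of x] by auto
  ultimately show ?thesis using z by simp
qed

text \<open>Frequencies are enumerated by \<open>int_decode\<close> so that results on series over
  \<open>nat\<close> (M-test, termwise differentiation) apply; real parts keep the values real
  whatever the coefficients are.\<close>

definition fourier_series :: "(nat \<Rightarrow> complex) \<Rightarrow> real \<Rightarrow> real" where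
  "fourier_series c x = (\<Sum>n. Re (c n * wave (int_decode n) x))"

lemma abs_fourier_term_le: "\<bar>Re (c * wave k x)\<bar> \<le> cmod c"
  using abs_Re_le_cmod[of "c * wave k x"] by (simp add: norm_mult)

context
  fixes c :: "nat \<Rightarrow> complex"
  assumes c: "summable (\<lambda>n. cmod (c n))"
begin

lemma summable_fourier_terms: "summable (\<lambda>n. \<bar>Re (c n * wave (int_decode n) x)\<bar>)"
  by (rule summable_comparison_test'[OF c]) (simp add: abs_fourier_term_le del: times_complex.sel)

lemma abs_fourier_series_le: "\<bar>fourier_series c x\<bar> \<le> (\<Sum>n. cmod (c n))"
  unfolding fourier_series_def
  by (rule order_trans[OF summable_rabs[OF summable_fourier_terms]])
     (rule suminf_le[OF abs_fourier_term_le summable_fourier_terms c])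

lemma uniform_limit_fourier_series:
  "uniform_limit S (\<lambda>N x. \<Sum>n<N. Re (c n * wave (int_decode n) x)) (fourier_series c) sequentially"
  unfolding fourier_series_def
  by (rule Weierstrass_m_test[OF _ c]) (simp add: abs_fourier_term_le del: times_complex.sel)

lemma continuous_on_fourier_series: "continuous_on S (fourier_series c)"
  by (rule uniform_limit_theorem[OF _ uniform_limit_fourier_series])
     (auto intro!: always_eventually continuous_intros simp del: times_complex.sel)

text \<open>As only real parts are summed, what comes back is the Hermitian symmetrisation of
  \<open>c\<close>, which is \<open>c\<close> itself for the coefficients of a real function.
  Uniform convergence permits integration term by term.\<close>

lemma integral_fourier_series:
  "integral {0..1} (\<lambda>x. of_real (fourier_series c x) * wave (- k) x) =
     (c (int_encode k) + cnj (c (int_encode (- k)))) / 2"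
proof -
  define t where "t n x = complex_of_real (Re (c n * wave (int_decode n) x)) * wave (- k) x" for n x
  have s: "(\<lambda>n. t n x) sums (of_real (fourier_series c x) * wave (- k) x)" for x
    unfolding t_def fourier_series_def
    by (rule sums_mult2, rule sums_of_real, rule summable_sums, rule summable_rabs_cancel,
        rule summable_fourier_terms)
  have u: "uniform_limit {0..1} (\<lambda>N x. \<Sum>n<N. t n x)
      (\<lambda>x. of_real (fourier_series c x) * wave (- k) x) sequentially"
  proof -
    have "uniform_limit {0..1} (\<lambda>N x. \<Sum>n<N. t n x) (\<lambda>x. \<Sum>n. t n x) sequentially"
      by (rule Weierstrass_m_test[OF _ c])
         (simp add: t_def norm_mult abs_fourier_term_le del: times_complex.sel)
    then show ?thesis by (simp only: sums_unique[OF s, symmetric])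
  qed
  obtain I J where IJ: "\<And>N. ((\<lambda>x. \<Sum>n<N. t n x) has_integral I N) {0..1}"
      "((\<lambda>x. of_real (fourier_series c x) * wave (- k) x) has_integral J) {0..1}" "I \<longlonglongrightarrow> J"
    by (rule uniform_limit_integral[OF u])
       (auto simp: t_def simp del: times_complex.sel intro!: continuous_intros)
  \<comment> \<open>The two contributions are added, not treated as alternatives: for
    \<open>k = 0\<close> both indices coincide.\<close>
  define a where "a n = (if n = int_encode k then c n / 2 else 0) +
      (if n = int_encode (- k) then cnj (c n) / 2 else 0)" for n
  have ti: "(t n has_integral a n) {0..1}" for n
  proof -
    have t: "t n = (\<lambda>x. c n / 2 * wave (int_decode n + - k) x + cnj (c n) / 2 * wave (- int_decode n + - k) x)"
    proof
      fix x
      have "t n x = (c n * wave (int_decode n) x + cnj (c n * wave (int_decode n) x)) / 2 * wave (- k) x"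
        unfolding t_def by (simp only: complex_add_cnj) simp
      also have "\<dots> = (c n * wave (int_decode n) x + cnj (c n) * wave (- int_decode n) x) / 2 * wave (- k) x"
        by (simp only: complex_cnj_mult cnj_wave)
      also have "\<dots> = c n / 2 * (wave (int_decode n) x * wave (- k) x)
          + cnj (c n) / 2 * (wave (- int_decode n) x * wave (- k) x)"
        by (simp add: add_divide_distrib distrib_right mult.assoc)
      finally show "t n x = c n / 2 * wave (int_decode n + - k) x + cnj (c n) / 2 * wave (- int_decode n + - k) x"
        by (simp only: wave_mult)
    qed
    have enc: "n = int_encode j \<longleftrightarrow> int_decode n = j" for j by auto
    have a: "a n = c n / 2 * (if int_decode n + - k = 0 then 1 else 0) +
        cnj (c n) / 2 * (if - int_decode n + - k = 0 then 1 else 0)"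
      unfolding a_def enc by (cases "int_decode n = k"; cases "int_decode n = - k") auto
    show ?thesis unfolding t a
      by (intro has_integral_add has_integral_mult_right has_integral_wave)
  qed
  have "I N = (\<Sum>n<N. a n)" for N
    by (rule has_integral_unique[OF IJ(1) has_integral_sum[OF finite_lessThan ti]])
  then have "I = (\<lambda>N. \<Sum>n<N. a n)" by blast
  then have "a sums J" using IJ(3) by (simp add: sums_def)
  moreover have "a sums (c (int_encode k) / 2 + cnj (c (int_encode (- k))) / 2)"
    unfolding a_def using sums_single[of "int_encode k" "\<lambda>n. c n / 2"]
      sums_single[of "int_encode (-k)" "\<lambda>n. cnj (c n) / 2"] by (intro sums_add) auto
  ultimately have "J = c (int_encode k) / 2 + cnj (c (int_encode (- k))) / 2" by (rule sums_unique2)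
  then show ?thesis using integral_unique[OF IJ(2)] by (simp add: add_divide_distrib)
qed

end

lemma fourier_series_has_real_derivative:
  assumes "summable (\<lambda>n. cmod (c n))"
    and d: "summable (\<lambda>n. cmod (2 * pi * of_int (int_decode n) * \<i> * c n))"
  shows "(fourier_series c has_real_derivative
     fourier_series (\<lambda>n. 2 * pi * of_int (int_decode n) * \<i> * c n) x) (at x)"
  unfolding fourier_series_def
proof (rule has_field_derivative_series'(2)[where S = UNIV and ?x0.0 = 0])
  show "uniformly_convergent_on UNIV
     (\<lambda>N x. \<Sum>n<N. Re (2 * pi * of_int (int_decode n) * \<i> * c n * wave (int_decode n) x))"
    unfolding uniformly_convergent_on_def using uniform_limit_fourier_series[OF d] by blast
  show "summable (\<lambda>n. Re (c n * wave (int_decode n) 0))"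
    by (rule summable_rabs_cancel, rule summable_fourier_terms) fact
  show "((\<lambda>x. Re (c n * wave (int_decode n) x)) has_real_derivative
      Re (2 * pi * of_int (int_decode n) * \<i> * c n * wave (int_decode n) x)) (at x within UNIV)" for n x
  proof -
    have "((\<lambda>x. Re (c n * wave (int_decode n) x)) has_vector_derivative
        Re (c n * ((2 * pi * of_int (int_decode n) * \<i>) * wave (int_decode n) x))) (at x)"
      by (rule bounded_linear.has_vector_derivative[OF bounded_linear_Re
          has_vector_derivative_mult_right[OF wave_has_vector_derivative]])
    then show ?thesis by (simp add: has_real_derivative_iff_has_vector_derivative ac_simps del: times_complex.sel)
  qed
qed auto

section \<open>Fourier coefficients and Fourier inversion\<close>

lemma fourier_coeff_continuous:
  assumes "continuous_on UNIV f"
  shows "fourier_coeff f k = integral {0..1} (\<lambda>x. of_real (f x) * wave (- k) x)"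
proof -
  have "continuous_on {0..1} (\<lambda>x. complex_of_real (f x) * wave (- k) x)"
    by (intro continuous_intros continuous_on_subset[OF assms]) auto
  from set_lebesgue_integral_eq_integral(2)[OF absolutely_integrable_continuous_real[OF this]]
  show ?thesis by (simp add: fourier_coeff_def wave_def)
qed

lemma fourier_coeff_cnj: "continuous_on UNIV f \<Longrightarrow> cnj (fourier_coeff f k) = fourier_coeff f (- k)"
  by (simp add: fourier_coeff_continuous integral_cnj cnj_wave)

lemma fourier_coeff_diff:
  assumes "continuous_on UNIV f" "continuous_on UNIV g"
  shows "fourier_coeff (\<lambda>x. f x - g x) k = fourier_coeff f k - fourier_coeff g k"
proof -
  have i: "(\<lambda>x. complex_of_real (h x) * wave (- k) x) integrable_on {0..1}"
    if "continuous_on UNIV h" for h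
    by (intro integrable_continuous_real continuous_intros continuous_on_subset[OF that]) auto
  have "continuous_on UNIV (\<lambda>x. f x - g x)" by (intro continuous_intros assms)
  then show ?thesis
    using integral_diff[OF i[OF assms(1)] i[OF assms(2)]] assms
    by (simp add: fourier_coeff_continuous left_diff_distrib)
qed

lemma fourier_coeff_divide:
  assumes "continuous_on UNIV f"
  shows "fourier_coeff (\<lambda>x. f x / a) k = fourier_coeff f k / of_real a"
proof -
  have "continuous_on UNIV (\<lambda>x. f x / a)"
    using continuous_on_mult_right[OF assms, of "inverse a"] by (simp add: divide_inverse)
  then show ?thesis using assms by (simp add: fourier_coeff_continuous)
qed

text \<open>Inversion from absolute summability alone: the series is a continuous periodic function
  with the same coefficients as \<open>f\<close>, so the difference is orthogonal to every wave and
  vanishes.\<close>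

lemma eq_fourier_series:
  assumes cont: "continuous_on UNIV f" and per: "periodic_fun_simple' f"
    and s: "summable (\<lambda>n. cmod (fourier_coeff f (int_decode n)))"
  shows "f x = fourier_series (\<lambda>n. fourier_coeff f (int_decode n)) x"
proof -
  interpret periodic_fun_simple' f by fact
  let ?S = "fourier_series (\<lambda>n. fourier_coeff f (int_decode n))"
  have cS: "continuous_on UNIV ?S" by (rule continuous_on_fourier_series[OF s])
  have "f x - ?S x = 0"
  proof (rule periodic_orthogonal_waves_eq_0[where d = "\<lambda>x. f x - ?S x"])
    show "continuous_on UNIV (\<lambda>x. f x - ?S x)" by (intro continuous_intros cont cS)
    have "wave k (x + 1) = wave k x" for k x
    proof -
      have "wave k (x + 1) = wave k x * cis (2 * pi * of_int k)"
        unfolding wave_def cis_mult by (simp add: distrib_left)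
      then show ?thesis by simp
    qed
    then show "periodic_fun_simple' (\<lambda>x. f x - ?S x)"
      by unfold_locales (simp add: plus_1 fourier_series_def)
    fix k
    have "integral {0..1} (\<lambda>x. of_real (f x - ?S x) * wave (- (- k)) x) =
        fourier_coeff (\<lambda>x. f x - ?S x) (- k)"
      by (rule fourier_coeff_continuous[symmetric]) (intro continuous_intros cont cS)
    also have "\<dots> = fourier_coeff f (- k) - fourier_coeff ?S (- k)"
      by (rule fourier_coeff_diff[OF cont cS])
    also have "fourier_coeff ?S (- k) = fourier_coeff f (- k)"
      using integral_fourier_series[OF s, of "- k"] fourier_coeff_cnj[OF cont, of k]
      by (simp add: fourier_coeff_continuous[OF cS])
    finally show "integral {0..1} (\<lambda>x. of_real (f x - ?S x) * wave k x) = 0" by simp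
  qed
  then show ?thesis by simp
qed

section \<open>Sobolev embedding\<close>

lemma summable_on_int_iff:
  fixes f :: "int \<Rightarrow> real"
  assumes "\<And>k. f k \<ge> 0"
  shows "f summable_on UNIV \<longleftrightarrow> summable (\<lambda>n. f (int_decode n))"
    and "f summable_on UNIV \<Longrightarrow> infsum f UNIV = (\<Sum>n. f (int_decode n))"
proof -
  have *: "(\<lambda>n. f (int_decode n)) summable_on UNIV \<longleftrightarrow> f summable_on UNIV"
    by (rule summable_on_reindex_bij_betw[OF bij_int_decode])
  have **: "(\<lambda>n. f (int_decode n)) summable_on UNIV \<longleftrightarrow> summable (\<lambda>n. f (int_decode n))"
    by (rule summable_on_UNIV_nonneg_real_iff) (rule assms)
  show "f summable_on UNIV \<longleftrightarrow> summable (\<lambda>n. f (int_decode n))" using * ** by simp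
  assume "f summable_on UNIV"
  then have "(\<lambda>n. f (int_decode n)) summable_on UNIV" using * by simp
  from has_sum_imp_sums[OF has_sum_infsum[OF this]]
  have "(\<Sum>n. f (int_decode n)) = infsum (\<lambda>n. f (int_decode n)) UNIV" by (rule sums_unique[symmetric])
  also have "\<dots> = infsum f UNIV"
    by (rule infsum_reindex_bij_betw[OF bij_int_decode])
  finally show "infsum f UNIV = (\<Sum>n. f (int_decode n))" by (rule sym)
qed

lemma sobolev_weight_nonneg: "sobolev_weight s k \<ge> 0"
  by (simp add: sobolev_weight_def)

text \<open>The origin of the 1/2 in the embedding: away from 0 the weight is at most |k| to the
  power 2 \<rho>, and such a series converges when 2 \<rho> < -1.\<close>

lemma summable_sobolev_weight:
  assumes "\<rho> < - 1/2"
  shows "summable (\<lambda>n. sobolev_weight \<rho> (int_decode n))"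
proof -
  have le: "sobolev_weight \<rho> k \<le> \<bar>of_int k\<bar> powr (2 * \<rho>)" if "k \<noteq> 0" for k
  proof -
    have "1 \<le> (2 * pi)\<^sup>2" using pi_gt3 by (intro one_le_power) auto
    then have "1 * (of_int k)\<^sup>2 \<le> (2 * pi)\<^sup>2 * (of_int k)\<^sup>2"
      by (intro mult_right_mono) auto
    then have "(of_int k)\<^sup>2 \<le> 1 + (2 * pi * of_int k)\<^sup>2" by (simp add: power_mult_distrib)
    then have "sobolev_weight \<rho> k \<le> ((of_int k)\<^sup>2) powr \<rho>"
      unfolding sobolev_weight_def using assms that by (intro powr_mono2') auto
    also have "(of_int k)\<^sup>2 = \<bar>real_of_int k\<bar> powr 2" using that by (simp add: powr_numeral)
    also have "(\<bar>real_of_int k\<bar> powr 2) powr \<rho> = \<bar>of_int k\<bar> powr (2 * \<rho>)" by (rule powr_powr)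
    finally show ?thesis .
  qed
  have s: "summable (\<lambda>n. real n powr (2 * \<rho>))" using assms by (simp add: summable_real_powr_iff)
  have half: "(\<lambda>k. sobolev_weight \<rho> k) summable_on range h"
    if h: "inj h" "\<And>n. \<bar>h n\<bar> = int n" for h
  proof -
    have "summable (\<lambda>n. sobolev_weight \<rho> (h n))"
    proof (rule summable_comparison_test'[OF s])
      \<comment> \<open>Frequency 0 is left out because \<open>0 powr (2 * \<rho>)\<close> is 0
        while the weight there is 1.\<close>
      fix n :: nat assume n: "n \<ge> 1"
      then have "h n \<noteq> 0" using h(2)[of n] by auto
      moreover have "\<bar>real_of_int (h n)\<bar> = real n" using h(2)[of n] by linarith
      ultimately show "norm (sobolev_weight \<rho> (h n)) \<le> real n powr (2 * \<rho>)"
        using le[of "h n"] sobolev_weight_nonneg[of \<rho> "h n"] by simp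
    qed
    then have "(sobolev_weight \<rho> \<circ> h) summable_on UNIV"
      by (subst summable_on_UNIV_nonneg_real_iff) (auto simp: sobolev_weight_nonneg o_def)
    then show ?thesis using summable_on_reindex[OF h(1)] by blast
  qed
  have "sobolev_weight \<rho> summable_on (range int \<union> range (\<lambda>n. - int n))"
    using half[of int] half[of "\<lambda>n. - int n"] by (intro summable_on_union) (auto simp: inj_on_def)
  moreover have "range int \<union> range (\<lambda>n. - int n) = UNIV"
    by (auto simp: image_iff) (metis int_cases2)
  ultimately show ?thesis using summable_on_int_iff(1)[of "sobolev_weight \<rho>"] sobolev_weight_nonneg by simp
qed

text \<open>The continuous representatives of the elements of \<^const>\<open>sobolev\<close>.\<close>

definition continuous_sobolev :: "real \<Rightarrow> (real \<Rightarrow> real) \<Rightarrow> bool" where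
  "continuous_sobolev r f \<longleftrightarrow> continuous_on UNIV f \<and> periodic_fun_simple' f \<and>
     summable (\<lambda>n. sobolev_weight r (int_decode n) * (cmod (fourier_coeff f (int_decode n)))\<^sup>2)"

lemma continuous_sobolevI: "f \<in> sobolev r \<Longrightarrow> continuous_on UNIV f \<Longrightarrow> continuous_sobolev r f"
  using summable_on_int_iff(1)[of "\<lambda>k. sobolev_weight r k * (cmod (fourier_coeff f k))\<^sup>2"]
  by (simp add: sobolev_def continuous_sobolev_def sobolev_weight_nonneg)

text \<open>Needed since \<open>u r\<close> lies in H^s while its difference quotients in time are
  measured in H^(s-1).\<close>

lemma continuous_sobolev_mono:
  assumes f: "continuous_sobolev r f" and "r' \<le> r"
  shows "continuous_sobolev r' f"
proof -
  have "sobolev_weight r' k \<le> sobolev_weight r k" for k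
    unfolding sobolev_weight_def using assms(2) by (intro powr_mono) auto
  note le = this
  have "summable (\<lambda>n. sobolev_weight r' (int_decode n) * (cmod (fourier_coeff f (int_decode n)))\<^sup>2)"
  proof (rule summable_comparison_test')
    show "summable (\<lambda>n. sobolev_weight r (int_decode n) * (cmod (fourier_coeff f (int_decode n)))\<^sup>2)"
      using f by (simp add: continuous_sobolev_def)
  qed (simp add: sobolev_weight_nonneg mult_right_mono le)
  then show ?thesis using f by (simp add: continuous_sobolev_def)
qed

text \<open>Membership has to be tracked explicitly: the infinite sum in \<open>sobolev_norm\<close>
  is 0 by default when it diverges, so a small norm says nothing about a function whose summability
  is unknown.\<close>

lemma continuous_sobolev_diff:
  assumes f: "continuous_sobolev r f" and g: "continuous_sobolev r g"
  shows "continuous_sobolev r (\<lambda>x. f x - g x)"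
proof -
  let ?s = "\<lambda>h n. sobolev_weight r (int_decode n) * (cmod (fourier_coeff h (int_decode n)))\<^sup>2"
  have c: "continuous_on UNIV f" "continuous_on UNIV g" using f g by (auto simp: continuous_sobolev_def)
  have "norm (?s (\<lambda>x. f x - g x) n) \<le> 2 * (?s f n + ?s g n)" for n
  proof -
    let ?k = "int_decode n"
    have "(cmod (fourier_coeff (\<lambda>x. f x - g x) ?k))\<^sup>2 \<le> (cmod (fourier_coeff f ?k) + cmod (fourier_coeff g ?k))\<^sup>2"
      unfolding fourier_coeff_diff[OF c] by (intro power_mono norm_triangle_ineq4) auto
    also have "\<dots> \<le> 2 * ((cmod (fourier_coeff f ?k))\<^sup>2 + (cmod (fourier_coeff g ?k))\<^sup>2)"
      using sum_squares_bound[of "cmod (fourier_coeff f ?k)" "cmod (fourier_coeff g ?k)"]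
      by (simp add: power2_sum)
    finally show ?thesis
      using mult_left_mono[OF _ sobolev_weight_nonneg[of r ?k],
          of "(cmod (fourier_coeff (\<lambda>x. f x - g x) ?k))\<^sup>2"
             "2 * ((cmod (fourier_coeff f ?k))\<^sup>2 + (cmod (fourier_coeff g ?k))\<^sup>2)"]
        sobolev_weight_nonneg[of r ?k]
      by (simp add: distrib_left)
  qed
  note le = this
  have "summable (\<lambda>n. 2 * (?s f n + ?s g n))"
    using f g by (intro summable_mult summable_add) (auto simp: continuous_sobolev_def)
  then have "summable (?s (\<lambda>x. f x - g x))"
    by (rule summable_comparison_test') (rule le)
  moreover have "periodic_fun_simple' (\<lambda>x. f x - g x)"
    using f g by (simp add: continuous_sobolev_def periodic_fun_simple'_def)
  moreover have "continuous_on UNIV (\<lambda>x. f x - g x)" by (intro continuous_intros c)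
  ultimately show ?thesis by (simp add: continuous_sobolev_def)
qed

lemma continuous_sobolev_divide:
  assumes f: "continuous_sobolev r f"
  shows "continuous_sobolev r (\<lambda>x. f x / a)"
proof -
  have c: "continuous_on UNIV f" using f by (simp add: continuous_sobolev_def)
  have "continuous_on UNIV (\<lambda>x. f x / a)"
    using continuous_on_mult_right[OF c, of "inverse a"] by (simp add: divide_inverse)
  moreover have "summable (\<lambda>n. sobolev_weight r (int_decode n) *
      (cmod (fourier_coeff (\<lambda>x. f x / a) (int_decode n)))\<^sup>2)"
  proof -
    have "sobolev_weight r k * (cmod (fourier_coeff (\<lambda>x. f x / a) k))\<^sup>2 =
        sobolev_weight r k * (cmod (fourier_coeff f k))\<^sup>2 / a\<^sup>2" for k
      unfolding fourier_coeff_divide[OF c] by (simp add: norm_divide power_divide)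
    moreover have "summable (\<lambda>n. sobolev_weight r (int_decode n) * (cmod (fourier_coeff f (int_decode n)))\<^sup>2 / a\<^sup>2)"
      by (rule summable_divide) (use f in \<open>simp add: continuous_sobolev_def\<close>)
    ultimately show ?thesis by presburger
  qed
  ultimately show ?thesis using f
    by (simp add: continuous_sobolev_def periodic_fun_simple'_def)
qed

text \<open>Cauchy-Schwarz: with w = 1 + (2 pi k)^2, the term w^(q/2) |f_k| is the product of
  w^((q-r)/2) and w^(r/2) |f_k|. The first factor is square summable since q - r < -1/2 and provides
  the constant; the second has l2 norm \<open>sobolev_norm r f\<close>.\<close>

lemma sobolev_embedding_l1:
  assumes "r > q + 1/2"
  shows "\<exists>C\<ge>0. \<forall>f. continuous_sobolev r f \<longrightarrow>
     summable (\<lambda>n. sobolev_weight (q / 2) (int_decode n) * cmod (fourier_coeff f (int_decode n))) \<and>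
     (\<Sum>n. sobolev_weight (q / 2) (int_decode n) * cmod (fourier_coeff f (int_decode n)))
        \<le> C * sobolev_norm r f"
proof (intro exI conjI allI impI)
  define b where "b n = sobolev_weight (q - r) (int_decode n)" for n
  have b: "summable b" unfolding b_def using assms by (intro summable_sobolev_weight) auto
  have b0: "b n \<ge> 0" for n by (simp add: b_def sobolev_weight_nonneg)
  define C where "C = sqrt (suminf b)"
  show "C \<ge> 0" by (simp add: C_def suminf_nonneg b b0)
  fix f assume f: "continuous_sobolev r f"
  define a where "a n = sobolev_weight r (int_decode n) * (cmod (fourier_coeff f (int_decode n)))\<^sup>2" for n
  have a: "summable a" using f by (simp add: a_def[abs_def] continuous_sobolev_def)
  have a0: "a n \<ge> 0" for n by (simp add: a_def sobolev_weight_nonneg)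
  have norm: "sobolev_norm r f = sqrt (suminf a)"
    unfolding sobolev_norm_def a_def
    using a summable_on_int_iff[of "\<lambda>k. sobolev_weight r k * (cmod (fourier_coeff f k))\<^sup>2"]
    by (simp add: sobolev_weight_nonneg a_def[abs_def])
  let ?t = "\<lambda>n. sobolev_weight (q / 2) (int_decode n) * cmod (fourier_coeff f (int_decode n))"
  have t: "?t n = sqrt (b n) * sqrt (a n)" for n
  proof -
    define w where "w = 1 + (2 * pi * of_int (int_decode n))\<^sup>2"
    have w: "w > 0" unfolding w_def by (rule add_pos_nonneg) auto
    have "sqrt (b n) * sqrt (a n) = sqrt (w powr (q - r) * w powr r) * cmod (fourier_coeff f (int_decode n))"
      by (simp add: a_def b_def sobolev_weight_def w_def real_sqrt_mult)
    also have "w powr (q - r) * w powr r = (w powr (q / 2))\<^sup>2"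
      using w by (simp add: power2_eq_square flip: powr_add)
    finally show ?thesis by (simp add: sobolev_weight_def w_def)
  qed
  have bound: "sum ?t {..<N} \<le> C * sobolev_norm r f" for N
  proof -
    have "sum ?t {..<N} = (\<Sum>n<N. \<bar>sqrt (b n)\<bar> * \<bar>sqrt (a n)\<bar>)"
      by (simp add: t a0 b0)
    also have "\<dots> \<le> L2_set (\<lambda>n. sqrt (b n)) {..<N} * L2_set (\<lambda>n. sqrt (a n)) {..<N}"
      by (rule L2_set_mult_ineq)
    also have "\<dots> = sqrt (sum b {..<N}) * sqrt (sum a {..<N})"
      by (simp add: L2_set_def a0 b0)
    also have "\<dots> \<le> C * sobolev_norm r f"
      unfolding C_def norm
      by (intro mult_mono real_sqrt_le_mono sum_le_suminf[OF a] sum_le_suminf[OF b])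
         (auto simp: a0 b0 sum_nonneg suminf_nonneg[OF a] suminf_nonneg[OF b])
    finally show ?thesis .
  qed
  have t0: "?t n \<ge> 0" for n by (simp add: sobolev_weight_nonneg)
  show s: "summable ?t" by (rule summableI_nonneg_bounded[OF t0 bound])
  show "suminf ?t \<le> C * sobolev_norm r f" by (rule suminf_le_const[OF s bound])
qed

text \<open>Differentiating term by term multiplies the coefficients by powers of 2 pi k, whose size
  up to order \<open>j\<close> is controlled by the weight of order j/2. As \<open>deriv\<close> is
  total, the last clause records separately that the iterated derivatives really are
  derivatives.\<close>

theorem sobolev_embedding:
  assumes "r > real j + 1/2"
  obtains C where "C \<ge> 0"
    "\<And>f i x. continuous_sobolev r f \<Longrightarrow> i \<le> j \<Longrightarrow> \<bar>(deriv ^^ i) f x\<bar> \<le> C * sobolev_norm r f"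
    "\<And>f i. continuous_sobolev r f \<Longrightarrow> i \<le> j \<Longrightarrow> continuous_on UNIV ((deriv ^^ i) f)"
    "\<And>f i x. continuous_sobolev r f \<Longrightarrow> i < j \<Longrightarrow>
       ((deriv ^^ i) f has_real_derivative (deriv ^^ Suc i) f x) (at x)"
proof -
  let ?w = "\<lambda>f n. sobolev_weight (real j / 2) (int_decode n) * cmod (fourier_coeff f (int_decode n))"
  from sobolev_embedding_l1[OF assms] obtain C where C0: "C \<ge> 0"
    and C': "\<forall>f. continuous_sobolev r f \<longrightarrow> summable (?w f) \<and> suminf (?w f) \<le> C * sobolev_norm r f"
    by (elim exE conjE)
  have C: "C \<ge> 0" "continuous_sobolev r f \<Longrightarrow> summable (?w f)"
    "continuous_sobolev r f \<Longrightarrow> suminf (?w f) \<le> C * sobolev_norm r f" for f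
    using C0 C'[rule_format, of f] by simp_all
  define c where "c f i n = (2 * pi * of_int (int_decode n) * \<i>) ^ i * fourier_coeff f (int_decode n)" for f i n
  have le: "cmod (c f i n) \<le> sobolev_weight (real j / 2) (int_decode n) * cmod (fourier_coeff f (int_decode n))"
    if "i \<le> j" for f i n
  proof -
    define y where "y = \<bar>2 * pi * of_int (int_decode n)\<bar>"
    have "y \<ge> 0" by (simp add: y_def)
    have "y ^ i \<le> (1 + y\<^sup>2) powr (real i / 2)"
    proof (cases "y = 0")
      case True
      then show ?thesis by (cases i) auto
    next
      case False
      then have "y ^ i = y powr (2 * (real i / 2))" using \<open>y \<ge> 0\<close> by (simp add: powr_realpow)
      also have "\<dots> = (y powr 2) powr (real i / 2)" by (rule powr_powr[symmetric])
      also have "y powr 2 = y\<^sup>2" using False \<open>y \<ge> 0\<close> by (simp add: powr_numeral)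
      also have "(y\<^sup>2) powr (real i / 2) \<le> (1 + y\<^sup>2) powr (real i / 2)" by (intro powr_mono2) auto
      finally show ?thesis .
    qed
    also have "\<dots> \<le> (1 + y\<^sup>2) powr (real j / 2)" using that by (intro powr_mono) auto
    finally have "y ^ i \<le> sobolev_weight (real j / 2) (int_decode n)"
      by (simp add: y_def sobolev_weight_def)
    moreover have "cmod (c f i n) = y ^ i * cmod (fourier_coeff f (int_decode n))"
      by (simp add: c_def y_def norm_mult norm_power abs_mult)
    ultimately show ?thesis by (simp add: mult_right_mono)
  qed
  have s: "summable (\<lambda>n. cmod (c f i n))" if "continuous_sobolev r f" "i \<le> j" for f i
    by (rule summable_comparison_test'[OF C(2)[OF that(1)]]) (use le that in simp)
  have d: "(fourier_series (c f i) has_real_derivative fourier_series (c f (Suc i)) x) (at x)"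
    if "continuous_sobolev r f" "i < j" for f i x
  proof -
    have e: "c f (Suc i) = (\<lambda>n. 2 * pi * of_int (int_decode n) * \<i> * c f i n)" by (simp only: c_def[abs_def] power_Suc mult.assoc)
    show ?thesis
      using fourier_series_has_real_derivative[of "c f i" x] s[of f i] s[of f "Suc i"] that unfolding e by simp
  qed
  have e: "(deriv ^^ i) f = fourier_series (c f i)" if f: "continuous_sobolev r f" "i \<le> j" for f i
    using f(2)
  proof (induction i)
    case 0
    have "f x = fourier_series (\<lambda>n. fourier_coeff f (int_decode n)) x" for x
      using f(1) s[OF f(1), of 0] by (intro eq_fourier_series) (simp_all add: c_def continuous_sobolev_def)
    then have "fourier_series (c f 0) = f" by (auto simp: c_def[abs_def])
    then show ?case by simp
  next
    case (Suc i)
    have "deriv (fourier_series (c f i)) = fourier_series (c f (Suc i))"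
      using DERIV_imp_deriv[OF d[OF f(1), of i]] Suc.prems by (intro ext) simp
    then show ?case using Suc by simp
  qed
  show ?thesis
  proof
    fix f i x assume f: "continuous_sobolev r f"
    { assume i: "i \<le> j"
      have "\<bar>(deriv ^^ i) f x\<bar> \<le> (\<Sum>n. cmod (c f i n))"
        using abs_fourier_series_le[OF s[OF f i]] e[OF f i] by simp
      also have "\<dots> \<le> (\<Sum>n. sobolev_weight (real j / 2) (int_decode n) * cmod (fourier_coeff f (int_decode n)))"
        by (rule suminf_le[OF le[OF i] s[OF f i] C(2)[OF f]])
      also note C(3)[OF f]
      finally show "\<bar>(deriv ^^ i) f x\<bar> \<le> C * sobolev_norm r f" .
      show "continuous_on UNIV ((deriv ^^ i) f)"
        unfolding e[OF f i] by (rule continuous_on_fourier_series[OF s[OF f i]]) }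
    assume i: "i < j"
    then show "((deriv ^^ i) f has_real_derivative (deriv ^^ Suc i) f x) (at x)"
      using d[OF f i] e[OF f, of i] e[OF f, of "Suc i"] by simp
  qed (rule C(1))
qed

section \<open>A comparison principle for transport equations\<close>

text \<open>The maximum principle for the doubled variables \<open>(x, y)\<close>: at an interior maximum of
  \<open>f t y - f t x - \<psi> t * (y - x)\<close> the two space derivatives of \<open>f\<close> both equal \<open>\<psi> t\<close>, so no flow map
  of \<open>a\<close> is needed.\<close>

lemma transport_comparison:
  fixes f ft fx H a :: "real \<Rightarrow> real \<Rightarrow> real"
  assumes cont: "continuous_on ({0..\<delta>} \<times> UNIV) (\<lambda>(t, x). f t x)"
    and dt: "\<And>t x. t \<in> {0..\<delta>} \<Longrightarrow> ((\<lambda>r. f r x) has_real_derivative ft t x) (at t within {0..\<delta>})"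
    and dx: "\<And>t x. t \<in> {0..\<delta>} \<Longrightarrow> (f t has_real_derivative fx t x) (at x)"
    and eq: "\<And>t x. t \<in> {0..\<delta>} \<Longrightarrow> ft t x + a t x * fx t x = H t x"
    and per: "\<And>t x. t \<in> {0..\<delta>} \<Longrightarrow> f t (x + 1) = f t x + \<kappa> t"
    and \<kappa>: "\<And>t. t \<in> {0..\<delta>} \<Longrightarrow> \<kappa> t \<le> 0"
    and H: "\<And>t x y. t \<in> {0..\<delta>} \<Longrightarrow> x \<le> y \<Longrightarrow> H t y - H t x \<le> K * (y - x)"
    and a: "\<And>t x y. t \<in> {0..\<delta>} \<Longrightarrow> x \<le> y \<Longrightarrow> a t x - a t y \<le> A * (y - x)"
    and KA: "K \<ge> 0" "A \<ge> 0"
    and init: "\<And>x y. x \<le> y \<Longrightarrow> f 0 y \<le> f 0 x"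
    and t: "t \<in> {0..\<delta>}" and xy: "x \<le> y" "y \<le> x + 1"
  shows "f t y - f t x \<le> K * t * exp (A * t) * (y - x)"
proof -
  \<comment> \<open>The slack \<epsilon> makes the time derivative at the maximum strictly negative;
    it is removed at the end.\<close>
  have "f t y - f t x \<le> (K + \<epsilon>) * t * exp (A * t) * (y - x)" if \<epsilon>: "\<epsilon> > 0" for \<epsilon>
  proof (rule ccontr)
    assume neg: "\<not> ?thesis"
    \<comment> \<open>\<psi> starts at 0 and satisfies \<psi>' = (K + \<epsilon>) exp(A r) + A
      \<psi>, so it grows faster than K + A \<psi>, the largest rate that the equation allows for
      the slope.\<close>
    define \<psi> where "\<psi> r = (K + \<epsilon>) * r * exp (A * r)" for r
    define \<Phi> where "\<Phi> r z h = f r (z + h) - f r z - \<psi> r * h" for r z h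
    have \<psi>0: "\<psi> r \<ge> 0" if "r \<ge> 0" for r using that KA \<epsilon> by (simp add: \<psi>_def)
    \<comment> \<open>The increment \<kappa> over a period cancels in \<Phi>, so \<Phi> is periodic
      in \<open>z\<close> even when \<open>f\<close> is not, and a maximum can be sought over a
      compact set.\<close>
    have \<Phi>per: "\<Phi> r (frac z) h = \<Phi> r z h" if "r \<in> {0..\<delta>}" for r z h
    proof -
      interpret periodic_fun_simple' "\<lambda>z. \<Phi> r z h"
      proof
        fix z
        have "f r (z + 1 + h) = f r (z + h) + \<kappa> r" using per[OF that, of "z + h"] by (simp add: ac_simps)
        then show "\<Phi> r (z + 1) h = \<Phi> r z h" using per[OF that, of z] by (simp add: \<Phi>_def)
      qed
      show ?thesis using plus_of_int[of "frac z" "\<lfloor>z\<rfloor>"] by (simp add: frac_def)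
    qed
    let ?C = "{0..\<delta>} \<times> {0..1::real} \<times> {0..1::real}"
    have contC: "continuous_on ?C (\<lambda>(r, z, h). \<Phi> r z h)"
    proof -
      have "continuous_on ?C (\<lambda>w. (\<lambda>(t, x). f t x) (fst w, fst (snd w) + snd (snd w)))"
        by (rule continuous_on_compose2[OF cont]) (auto intro!: continuous_intros)
      moreover have "continuous_on ?C (\<lambda>w. (\<lambda>(t, x). f t x) (fst w, fst (snd w)))"
        by (rule continuous_on_compose2[OF cont]) (auto intro!: continuous_intros)
      ultimately show ?thesis
        unfolding \<Phi>_def \<psi>_def case_prod_beta by (auto intro!: continuous_intros)
    qed
    have cC: "compact ?C" by (intro compact_Times compact_Icc)
    have nC: "?C \<noteq> {}" using t by auto
    obtain w where w: "w \<in> ?C" "\<forall>v\<in>?C. (\<lambda>(r, z, h). \<Phi> r z h) v \<le> (\<lambda>(r, z, h). \<Phi> r z h) w"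
      using continuous_attains_sup[OF cC nC contC] by blast
    obtain t0 x0 h0 where w3: "w = (t0, x0, h0)" by (cases w)
    have t0: "t0 \<in> {0..\<delta>}" and h0: "h0 \<in> {0..1}" using w(1) w3 by auto
    have max: "\<Phi> r z h \<le> \<Phi> t0 x0 h0" if "r \<in> {0..\<delta>}" "h \<in> {0..1}" for r z h
    proof -
      have "(r, frac z, h) \<in> ?C" using that frac_lt_1[of z] by auto
      then have "\<Phi> r (frac z) h \<le> \<Phi> t0 x0 h0" using w(2)[rule_format, of "(r, frac z, h)"] w3 by simp
      then show ?thesis using \<Phi>per that by simp
    qed
    have "0 < \<Phi> t x (y - x)" using neg by (simp add: \<Phi>_def \<psi>_def)
    also have "\<dots> \<le> \<Phi> t0 x0 h0" using max t xy by auto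
    finally have pos: "\<Phi> t0 x0 h0 > 0" .
    have "h0 \<noteq> 0" using pos by (auto simp: \<Phi>_def)
    \<comment> \<open>On the face \<open>h = 1\<close> the value is \<kappa> - \<psi>; the sign of
      \<kappa> excludes a positive maximum there.\<close>
    moreover have "h0 \<noteq> 1"
    proof
      assume "h0 = 1"
      then have "\<Phi> t0 x0 h0 = \<kappa> t0 - \<psi> t0" using per[OF t0] by (simp add: \<Phi>_def)
      then show False using pos \<kappa>[OF t0] \<psi>0[of t0] t0 by simp
    qed
    ultimately have h0': "0 < h0" "h0 < 1" using h0 by auto
    have "t0 \<noteq> 0"
      using pos init[of x0 "x0 + h0"] h0' by (auto simp: \<Phi>_def \<psi>_def)
    then have t0': "t0 > 0" using t0 by auto
    have "((\<lambda>h. f t0 (x0 + h)) has_real_derivative fx t0 (x0 + h0)) (at h0)"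
      using DERIV_chain2[OF dx[OF t0], of "\<lambda>h. x0 + h" 1 h0] by (simp add: DERIV_add[OF DERIV_const DERIV_ident, simplified])
    note dh = DERIV_diff[OF DERIV_diff[OF this DERIV_const] DERIV_cmult_Id]
    have "((\<lambda>z. f t0 (z + h0)) has_real_derivative fx t0 (x0 + h0)) (at x0)"
      using dx[OF t0, of "x0 + h0"] DERIV_shift by blast
    note dz = DERIV_diff[OF DERIV_diff[OF this dx[OF t0]] DERIV_const]
    have "fx t0 (x0 + h0) - \<psi> t0 = 0"
    proof (rule DERIV_local_max[where f = "\<lambda>h. \<Phi> t0 x0 h" and x = h0 and d = "min h0 (1 - h0)"])
      show "((\<lambda>h. \<Phi> t0 x0 h) has_real_derivative fx t0 (x0 + h0) - \<psi> t0) (at h0)"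
        using dh[of "f t0 x0" "\<psi> t0"] by (simp add: \<Phi>_def)
      show "\<forall>y. \<bar>h0 - y\<bar> < min h0 (1 - h0) \<longrightarrow> \<Phi> t0 x0 y \<le> \<Phi> t0 x0 h0"
      proof (intro allI impI max[OF t0])
        fix y assume "\<bar>h0 - y\<bar> < min h0 (1 - h0)"
        then show "y \<in> {0..1}" by (simp add: abs_less_iff)
      qed
    qed (use h0' in simp)
    then have e1: "fx t0 (x0 + h0) = \<psi> t0" by simp
    have "fx t0 (x0 + h0) - fx t0 x0 = 0"
    proof (rule DERIV_local_max[where f = "\<lambda>z. \<Phi> t0 z h0" and x = x0 and d = 1])
      show "((\<lambda>z. \<Phi> t0 z h0) has_real_derivative fx t0 (x0 + h0) - fx t0 x0) (at x0)"
        using dz[of "\<psi> t0 * h0"] by (simp add: \<Phi>_def)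
    qed (use max[OF t0 h0] in auto)
    then have e2: "fx t0 x0 = \<psi> t0" using e1 by simp
    \<comment> \<open>The time derivative of \<Phi> at the maximum. As both space slopes equal
      \<psi>, only the variation of the speed \<open>a\<close> and of \<open>H\<close> between
      \<open>x0\<close> and \<open>x0 + h0\<close> contributes.\<close>
    define D where "D = ft t0 (x0 + h0) - ft t0 x0 - ((K + \<epsilon>) * exp (A * t0) + A * \<psi> t0) * h0"
    have "(\<psi> has_real_derivative (K + \<epsilon>) * exp (A * t0) + A * \<psi> t0) (at t0 within {0..\<delta>})"
      unfolding \<psi>_def by (auto intro!: derivative_eq_intros simp: algebra_simps)
    from DERIV_diff[OF DERIV_diff[OF dt[OF t0] dt[OF t0]] DERIV_cmult_right[OF this]]
    have Dt: "((\<lambda>r. \<Phi> r x0 h0) has_real_derivative D) (at t0 within {0..\<delta>})"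
      unfolding \<Phi>_def D_def .
    have "D < 0"
    proof -
      have "ft t0 (x0 + h0) - ft t0 x0 =
          H t0 (x0 + h0) - H t0 x0 + \<psi> t0 * (a t0 x0 - a t0 (x0 + h0))"
      proof -
        have "ft t0 x0 = H t0 x0 - a t0 x0 * \<psi> t0" "ft t0 (x0 + h0) = H t0 (x0 + h0) - a t0 (x0 + h0) * \<psi> t0"
          using eq[OF t0, of x0] eq[OF t0, of "x0 + h0"] unfolding e1 e2 by linarith+
        then show ?thesis by (simp add: algebra_simps)
      qed
      also have "\<dots> \<le> K * h0 + \<psi> t0 * (A * h0)"
        using H[OF t0, of x0 "x0 + h0"] a[OF t0, of x0 "x0 + h0"] h0' \<psi>0[of t0] t0
        by (intro add_mono mult_left_mono) auto
      also have "\<dots> < ((K + \<epsilon>) * exp (A * t0) + A * \<psi> t0) * h0"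
      proof -
        have "K + \<epsilon> \<le> (K + \<epsilon>) * exp (A * t0)" using KA \<epsilon> t0 by (simp add: mult_le_cancel_left1)
        then have "K < (K + \<epsilon>) * exp (A * t0)" using \<epsilon> by linarith
        then have "K * h0 < (K + \<epsilon>) * exp (A * t0) * h0" using h0' by simp
        then show ?thesis by (simp add: algebra_simps)
      qed
      finally show ?thesis by (simp add: D_def)
    qed
    \<comment> \<open>Only earlier times are compared, since the maximum may lie at the final time
      \<delta>.\<close>
    from has_real_derivative_neg_dec_left[OF Dt this] obtain d where d: "d > 0"
      "\<forall>k>0. t0 - k \<in> {0..\<delta>} \<longrightarrow> k < d \<longrightarrow> \<Phi> t0 x0 h0 < \<Phi> (t0 - k) x0 h0"
      by blast
    define k where "k = min (d / 2) t0"
    have "k > 0" "k < d" "t0 - k \<in> {0..\<delta>}" using d(1) t0 t0' by (auto simp: k_def)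
    then show False using d(2) max[OF _ h0, of "t0 - k" x0] by force
  qed
  note base = this
  have le: "f t y - f t x \<le> K * t * exp (A * t) * (y - x) + \<epsilon> * (t * exp (A * t) * (y - x))"
    if "\<epsilon> > 0" for \<epsilon>
    using base[OF that] by (simp only: distrib_right mult.assoc)
  define R where "R = t * exp (A * t) * (y - x)"
  have R: "R \<ge> 0" using t xy by (simp add: R_def)
  show ?thesis
  proof (rule field_le_epsilon)
    fix e :: real assume "e > 0"
    have "e / (R + 1) * R \<le> e" using \<open>e > 0\<close> R by (simp add: field_simps)
    then show "f t y - f t x \<le> K * t * exp (A * t) * (y - x) + e"
      using le[of "e / (R + 1)"] \<open>e > 0\<close> R unfolding R_def[symmetric] by force
  qed
qed

text \<open>Passes from the increment bounds of \<open>transport_comparison\<close>, available for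
  steps of length at most 1, to a pointwise bound on the space derivative.\<close>

lemma DERIV_le_of_right_slopes:
  fixes f :: "real \<Rightarrow> real"
  assumes "(f has_real_derivative D) (at x)"
    and "\<And>y. x \<le> y \<Longrightarrow> y \<le> x + 1 \<Longrightarrow> f y - f x \<le> L * (y - x)"
  shows "D \<le> L"
proof (rule ccontr)
  assume "\<not> D \<le> L"
  moreover have "((\<lambda>y. f y - L * y) has_real_derivative D - L) (at x)"
    by (rule derivative_eq_intros assms refl | simp)+
  ultimately obtain d where "d > 0" and d: "\<forall>h>0. h < d \<longrightarrow> f x - L * x < f (x + h) - L * (x + h)"
    using DERIV_pos_inc_right[of "\<lambda>y. f y - L * y" "D - L" x] by auto
  define h where "h = min (d / 2) 1"
  have "0 < h" "h < d" "h \<le> 1" using \<open>d > 0\<close> by (auto simp: h_def)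
  then show False using d assms(2)[of "x + h"] by (auto simp: algebra_simps)
qed

section \<open>Positivity, bounds and unique continuation for v - v'' = g on the circle\<close>

lemma helmholtz_solutionD:
  assumes "helmholtz_solution g v"
  shows "(v has_real_derivative deriv v x) (at x)"
    and "(deriv v has_real_derivative v x - g x) (at x)"
    and "v (x + 1) = v x" and "deriv v (x + 1) = deriv v x"
proof -
  obtain v' v'' where v: "\<And>x. (v has_real_derivative v' x) (at x)"
      "\<And>x. (v' has_real_derivative v'' x) (at x)" "\<And>x. v x - v'' x = g x"
    and per: "v (x + 1) = v x" for x
    using assms unfolding helmholtz_solution_def periodic_fun_simple'_def by blast
  have v': "deriv v = v'" using DERIV_imp_deriv[OF v(1)] by blast
  show "(v has_real_derivative deriv v x) (at x)" "v (x + 1) = v x" unfolding v' by (rule v per)+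
  have "v'' x = v x - g x" using v(3)[of x] by simp
  then show "(deriv v has_real_derivative v x - g x) (at x)" using v(2)[of x] unfolding v' by simp
  have "((\<lambda>x. v (x + 1)) has_real_derivative v' (x + 1)) (at x)" using DERIV_shift v(1) by blast
  then have "(v has_real_derivative v' (x + 1)) (at x)" by (simp add: per)
  then show "deriv v (x + 1) = deriv v x" unfolding v' using v(1) DERIV_unique by blast
qed

lemma helmholtz_solution_uminus:
  assumes v: "helmholtz_solution g v"
  shows "helmholtz_solution (\<lambda>x. - g x) (\<lambda>x. - v x)"
  unfolding helmholtz_solution_def
proof (intro conjI exI allI)
  note v = helmholtz_solutionD[OF v]
  show "periodic_fun_simple' (\<lambda>x. - v x)" by unfold_locales (simp add: v)
  show "((\<lambda>x. - v x) has_real_derivative - deriv v x) (at x)" for x by (intro derivative_intros v)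
  show "((\<lambda>x. - deriv v x) has_real_derivative - (v x - g x)) (at x)" for x by (intro derivative_intros v)
qed simp

lemma helmholtz_solution_add_const:
  assumes v: "helmholtz_solution g v"
  shows "helmholtz_solution (\<lambda>x. k + g x) (\<lambda>x. k + v x)"
  unfolding helmholtz_solution_def
proof (intro conjI exI allI)
  note v = helmholtz_solutionD[OF v]
  show "periodic_fun_simple' (\<lambda>x. k + v x)" by unfold_locales (simp add: v)
  show "((\<lambda>x. k + v x) has_real_derivative deriv v x) (at x)" for x
    using DERIV_add[OF DERIV_const v(1)] by simp
  show "(deriv v has_real_derivative v x - g x) (at x)" for x by (rule v)
qed simp

text \<open>The factorisation 1 - d^2/dx^2 = (1 - d/dx)(1 + d/dx): w = v' + v solves w - w' = g, and
  exp(-x) is the integrating factor.\<close>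

lemma helmholtz_factor_antimono:
  assumes v: "helmholtz_solution g v" and g: "\<And>x. g x \<ge> 0" and "x \<le> y"
  shows "(deriv v y + v y) * exp (- y) \<le> (deriv v x + v x) * exp (- x)"
proof (rule DERIV_nonpos_imp_nonincreasing[OF \<open>x \<le> y\<close>])
  fix z
  have "((\<lambda>z. (deriv v z + v z) * exp (- z)) has_real_derivative - g z * exp (- z)) (at z)"
    by (rule derivative_eq_intros helmholtz_solutionD[OF v] refl | simp add: algebra_simps)+
  moreover have "- g z * exp (- z) \<le> 0" using g[of z] by simp
  ultimately show "\<exists>d. ((\<lambda>z. (deriv v z + v z) * exp (- z)) has_real_derivative d) (at z) \<and> d \<le> 0" by blast
qed

text \<open>Across one period the periodic function v' + v gets multiplied by exp(-1) in a
  non-increasing expression, which is possible only if it is non-negative; v - v' is treated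
  likewise with exp(x). Together they also give positivity of \<open>v\<close>.\<close>

lemma abs_deriv_helmholtz_le:
  assumes v: "helmholtz_solution g v" and g: "\<And>x. g x \<ge> 0"
  shows "\<bar>deriv v x\<bar> \<le> v x"
proof -
  note D = helmholtz_solutionD[OF v]
  have scale: "z \<ge> 0" if "k * z \<ge> z" "k > 1" for k z :: real
    using that by (smt (verit, best) mult_le_cancel_right1)
  have "(deriv v x + v x) * exp (- x - 1) \<le> (deriv v x + v x) * exp (- x)"
    using helmholtz_factor_antimono[OF v g, of x "x + 1"] D by simp
  then have "(deriv v x + v x) * exp (- x - 1) * exp (x + 1) \<le> (deriv v x + v x) * exp (- x) * exp (x + 1)"
    by (intro mult_right_mono) auto
  moreover have "exp (- x - 1) * exp (x + 1) = 1" "exp (- x) * exp (x + 1) = exp 1"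
    by (simp_all flip: exp_add)
  ultimately have "exp 1 * (deriv v x + v x) \<ge> deriv v x + v x"
    by (simp only: mult.assoc) (simp only: mult.commute mult_1_left)
  then have 1: "deriv v x + v x \<ge> 0" by (rule scale) simp
  have "(v x - deriv v x) * exp x \<le> (v (x + 1) - deriv v (x + 1)) * exp (x + 1)"
  proof (rule DERIV_nonneg_imp_nondecreasing[where f = "\<lambda>x. (v x - deriv v x) * exp x"])
    fix z
    have "((\<lambda>z. (v z - deriv v z) * exp z) has_real_derivative g z * exp z) (at z)"
      by (rule derivative_eq_intros D refl | simp add: algebra_simps)+
    moreover have "g z * exp z \<ge> 0" using g[of z] by simp
    ultimately show "\<exists>d. ((\<lambda>z. (v z - deriv v z) * exp z) has_real_derivative d) (at z) \<and> d \<ge> 0" by blast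
  qed simp
  then have "(v x - deriv v x) * exp x * exp (- x) \<le> (v x - deriv v x) * exp (x + 1) * exp (- x)"
    using D by (intro mult_right_mono) auto
  moreover have "exp x * exp (- x) = 1" "exp (x + 1) * exp (- x) = exp 1"
    by (simp_all flip: exp_add)
  ultimately have "exp 1 * (v x - deriv v x) \<ge> v x - deriv v x"
    by (simp only: mult.assoc) (simp only: mult.commute mult_1_left)
  then have 2: "v x - deriv v x \<ge> 0" by (rule scale) simp
  show ?thesis using 1 2 by linarith
qed

text \<open>Constants solve the equation with themselves as data, so \<open>S + g\<close> and
  \<open>S - g\<close> reduce everything to non-negative data. Then |v'| \<le> S + v \<le> 2 S, and
  v'' = v - g is bounded by 2 S, whence the Lipschitz bound.\<close>

lemma helmholtz_bounds:
  assumes v: "helmholtz_solution g v" and g: "\<And>x. \<bar>g x\<bar> \<le> S"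
  shows "\<bar>v x\<bar> \<le> S" and "\<bar>deriv v x\<bar> \<le> 2 * S" and "\<bar>deriv v y - deriv v x\<bar> \<le> 2 * S * \<bar>y - x\<bar>"
proof -
  note D = helmholtz_solutionD[OF v]
  have d: "deriv (\<lambda>x. S + v x) x = deriv v x" for x
    using DERIV_add[OF DERIV_const D(1)] by (intro DERIV_imp_deriv) simp
  have "0 \<le> S + g x" "0 \<le> S + - g x" for x using g[of x] by linarith+
  note pos = abs_deriv_helmholtz_le[OF helmholtz_solution_add_const[OF v] this(1)]
    abs_deriv_helmholtz_le[OF helmholtz_solution_add_const[OF helmholtz_solution_uminus[OF v]] this(2)]
  have b: "\<bar>v x\<bar> \<le> S" for x using pos[of x] by linarith
  show "\<bar>v x\<bar> \<le> S" by (rule b)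
  show "\<bar>deriv v x\<bar> \<le> 2 * S" using pos(1)[of x] b[of x] unfolding d by linarith
  have "norm (deriv v y - deriv v x) \<le> 2 * S * norm (y - x)"
  proof (rule field_differentiable_bound[where S = UNIV])
    fix z
    show "(deriv v has_field_derivative v z - g z) (at z within UNIV)" using D(2) by simp
    show "norm (v z - g z) \<le> 2 * S" using b[of z] g[of z] by simp
  qed auto
  then show "\<bar>deriv v y - deriv v x\<bar> \<le> 2 * S * \<bar>y - x\<bar>" by simp
qed

text \<open>On the interval where \<open>g\<close> vanishes, \<open>v'' = v \<ge> 0\<close> has integral zero, so \<open>v\<close> and \<open>v'\<close> vanish there;
  the monotone function \<open>(v' + v) e^-x\<close> then vanishes at all integer translates of a point, hence everywhere.\<close>

lemma helmholtz_unique_continuation: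
  assumes v: "helmholtz_solution g v" and g: "\<And>x. g x \<ge> 0"
    and ab: "\<alpha> < \<beta>" and g0: "\<And>x. \<alpha> < x \<Longrightarrow> x < \<beta> \<Longrightarrow> g x = 0"
    and d0: "deriv v \<alpha> = 0" "deriv v \<beta> = 0"
  shows "g x = 0"
proof -
  note D = helmholtz_solutionD[OF v]
  have v0: "v x \<ge> 0" for x using abs_deriv_helmholtz_le[OF v g, of x] by linarith
  have cont: "continuous_on S (deriv v)" for S
    by (rule DERIV_continuous_on[OF has_field_derivative_at_within[OF D(2)]])
  have mono: "deriv v x \<le> deriv v y" if "\<alpha> \<le> x" "x \<le> y" "y \<le> \<beta>" for x y
  proof (rule DERIV_nonneg_imp_increasing_open[OF that(2) _ cont])
    fix z assume "x < z" "z < y"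
    then have "(deriv v has_real_derivative v z) (at z)" using D(2)[of z] g0[of z] that by simp
    then show "\<exists>d. (deriv v has_real_derivative d) (at z) \<and> 0 \<le> d" using v0 by blast
  qed
  have z: "deriv v x = 0" if "\<alpha> \<le> x" "x \<le> \<beta>" for x
    using mono[of \<alpha> x] mono[of x \<beta>] that d0 by simp
  \<comment> \<open>At an interior point v' is locally constant, so its derivative v - g is 0 there,
    and g = 0 gives v = 0.\<close>
  define \<gamma> where "\<gamma> = (\<alpha> + \<beta>) / 2"
  have \<gamma>: "\<alpha> < \<gamma>" "\<gamma> < \<beta>" using ab by (auto simp: \<gamma>_def)
  have "v \<gamma> - g \<gamma> = 0"
  proof (rule DERIV_local_const[where f = "deriv v" and x = \<gamma> and d = "min (\<gamma> - \<alpha>) (\<beta> - \<gamma>)"])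
    show "(deriv v has_real_derivative v \<gamma> - g \<gamma>) (at \<gamma>)" by (rule D)
    show "\<forall>y. \<bar>\<gamma> - y\<bar> < min (\<gamma> - \<alpha>) (\<beta> - \<gamma>) \<longrightarrow> deriv v \<gamma> = deriv v y"
      using z \<gamma> by (auto simp: abs_less_iff)
  qed (use \<gamma> in auto)
  then have v\<gamma>: "v \<gamma> = 0" using g0 \<gamma> by simp
  define P where "P x = (deriv v x + v x) * exp (- x)" for x
  have anti: "P y \<le> P x" if "x \<le> y" for x y
    unfolding P_def by (rule helmholtz_factor_antimono[OF v g that])
  interpret w: periodic_fun_simple' "\<lambda>x. deriv v x + v x" by unfold_locales (simp add: D)
  have P0: "P (\<gamma> + of_int n) = 0" for n
    using w.plus_of_int[of \<gamma> n] z[of \<gamma>] \<gamma> v\<gamma> by (simp add: P_def)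
  have "P x = 0" for x
  proof -
    define n where "n = \<lceil>x - \<gamma>\<rceil>"
    have "x \<le> \<gamma> + of_int n" "\<gamma> + of_int (n - 1) \<le> x" unfolding n_def by linarith+
    from anti[OF this(1)] anti[OF this(2)] show ?thesis unfolding P0 by simp
  qed
  then have P_eq: "P = (\<lambda>x. 0)" by (rule ext)
  have "(P has_real_derivative - g x * exp (- x)) (at x)"
    unfolding P_def[abs_def]
    by (rule derivative_eq_intros D refl | simp add: algebra_simps)+
  then have "((\<lambda>x. 0) has_real_derivative - g x * exp (- x)) (at x)" unfolding P_eq .
  then have "- g x * exp (- x) = 0" by (rule DERIV_unique[OF _ DERIV_const])
  then show ?thesis by simp
qed

section \<open>Classical solutions of the nonlocal equation\<close>

text \<open>Closeness in time is asked only uniformly on bounded sets of \<open>x\<close>: for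
  primitives of \<open>u\<close> it is inherited from \<open>u\<close> with a factor |x|.\<close>

lemma continuous_on_joint:
  fixes f :: "real \<Rightarrow> real \<Rightarrow> real"
  assumes cont: "\<And>t. t \<in> S \<Longrightarrow> continuous_on UNIV (f t)"
    and unif: "\<And>t e R. t \<in> S \<Longrightarrow> e > 0 \<Longrightarrow> \<forall>\<^sub>F r in at t within S. \<forall>x. \<bar>x\<bar> \<le> R \<longrightarrow> \<bar>f r x - f t x\<bar> < e"
  shows "continuous_on (S \<times> UNIV) (\<lambda>(t, x). f t x)"
  unfolding continuous_on_iff
proof (intro ballI allI impI)
  fix z and e :: real assume z: "z \<in> S \<times> (UNIV :: real set)" and e: "e > 0"
  obtain t x where tx: "z = (t, x)" "t \<in> S" using z by auto
  obtain d1 where d1: "d1 > 0"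
    "\<And>r y. r \<in> S \<Longrightarrow> dist r t < d1 \<Longrightarrow> \<bar>y\<bar> \<le> \<bar>x\<bar> + 1 \<Longrightarrow> \<bar>f r y - f t y\<bar> < e / 2"
  proof -
    obtain d where "d > 0" "\<forall>r\<in>S. r \<noteq> t \<and> dist r t < d \<longrightarrow> (\<forall>y. \<bar>y\<bar> \<le> \<bar>x\<bar> + 1 \<longrightarrow> \<bar>f r y - f t y\<bar> < e / 2)"
      using unif[OF tx(2), of "e / 2" "\<bar>x\<bar> + 1"] e unfolding eventually_at by auto
    moreover have "\<bar>f t y - f t y\<bar> < e / 2" for y using e by simp
    ultimately show ?thesis using that[of d] by metis
  qed
  obtain d2 where d2: "d2 > 0" "\<And>y. dist y x < d2 \<Longrightarrow> dist (f t y) (f t x) < e / 2"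
    using cont[OF tx(2)] e unfolding continuous_on_iff by (meson UNIV_I half_gt_zero)
  show "\<exists>d>0. \<forall>z'\<in>S \<times> UNIV. dist z' z < d \<longrightarrow>
      dist (case z' of (t, x) \<Rightarrow> f t x) (case z of (t, x) \<Rightarrow> f t x) < e"
  proof (intro exI conjI ballI impI)
    show "min (min d1 d2) 1 > 0" using d1(1) d2(1) by simp
    fix z' assume z': "z' \<in> S \<times> (UNIV :: real set)" and d: "dist z' z < min (min d1 d2) 1"
    obtain r y where ry: "z' = (r, y)" "r \<in> S" using z' by auto
    have "dist r t \<le> dist z' z" "dist y x \<le> dist z' z"
      using dist_fst_le[of z' z] dist_snd_le[of z' z] by (simp_all add: ry tx)
    then have b: "dist r t < d1" "dist y x < d2" "dist y x < 1" using d by simp_all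
    have "\<bar>y\<bar> \<le> \<bar>x\<bar> + 1" using b(3) by (simp add: dist_real_def)
    then have "\<bar>f r y - f t y\<bar> < e / 2" using d1(2)[OF ry(2) b(1)] by simp
    moreover have "\<bar>f t y - f t x\<bar> < e / 2" using d2(2)[OF b(2)] by (simp add: dist_real_def)
    ultimately have "\<bar>f r y - f t x\<bar> < e" by linarith
    then show "dist (case z' of (t, x) \<Rightarrow> f t x) (case z of (t, x) \<Rightarrow> f t x) < e"
      by (simp add: tx ry dist_real_def)
  qed
qed

lemma deriv_periodic:
  fixes f :: "real \<Rightarrow> real"
  assumes "\<And>x. (f has_real_derivative f' x) (at x)" "\<And>x. f (x + 1) = f x"
  shows "f' (x + 1) = f' x"
proof -
  have "((\<lambda>x. f (x + 1)) has_real_derivative f' (x + 1)) (at x)" using DERIV_shift assms(1) by blast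
  then have "(f has_real_derivative f' (x + 1)) (at x)" by (simp add: assms(2))
  then show ?thesis using assms(1) by (rule DERIV_unique)
qed

lemma has_real_derivative_of_uniform_quotient:
  fixes f :: "real \<Rightarrow> real"
  assumes "\<And>e. e > 0 \<Longrightarrow> \<forall>\<^sub>F r in at t within S. \<bar>(f r - f t) / (r - t) - D\<bar> < e"
  shows "(f has_real_derivative D) (at t within S)"
  unfolding has_field_derivative_iff by (rule tendstoI) (simp add: dist_real_def assms)

lemma real_antiderivative:
  fixes f :: "real \<Rightarrow> real"
  assumes "continuous_on UNIV f"
  obtains F where "\<And>x. (F has_real_derivative f x) (at x)" "F 0 = 0"
proof -
  obtain F where F: "\<And>x. (F has_real_derivative f x) (at x)"
    using einterval_antiderivative[of "-\<infinity>" "\<infinity>" f] assms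
    by (auto simp: has_real_derivative_iff_has_vector_derivative continuous_on_eq_continuous_at)
  have "((\<lambda>x. F x - F 0) has_real_derivative f x) (at x)" for x
    using DERIV_diff[OF F DERIV_const] by simp
  then show ?thesis using that[of "\<lambda>x. F x - F 0"] by simp
qed

lemma abs_diff_le_of_DERIV:
  fixes f :: "real \<Rightarrow> real"
  assumes "convex S" "\<And>x. x \<in> S \<Longrightarrow> (f has_real_derivative f' x) (at x within S)"
    "\<And>x. x \<in> S \<Longrightarrow> \<bar>f' x\<bar> \<le> M" "x \<in> S" "y \<in> S"
  shows "\<bar>f y - f x\<bar> \<le> M * \<bar>y - x\<bar>"
  using field_differentiable_bound[of S f f' M y x] assms by simp

text \<open>\<open>A\<close> and \<open>B\<close> are the coefficients of the nonlinearity under \<open>\<partial>\<^sub>x \<Lambda>\<^sup>-\<^sup>2\<close>.\<close>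

locale classical_solution =
  fixes c A B T :: real and p :: nat and u ux ut :: "real \<Rightarrow> real \<Rightarrow> real"
  assumes p_pos: "p > 0"
    and per: "t \<in> {0..<T} \<Longrightarrow> u t (x + 1) = u t x"
    and dx: "t \<in> {0..<T} \<Longrightarrow> (u t has_real_derivative ux t x) (at x)"
    and cont_ux: "t \<in> {0..<T} \<Longrightarrow> continuous_on UNIV (ux t)"
    and unif: "t \<in> {0..<T} \<Longrightarrow> e > 0 \<Longrightarrow>
      \<forall>\<^sub>F r in at t within {0..<T}. \<forall>x. \<bar>u r x - u t x\<bar> < e \<and> \<bar>ux r x - ux t x\<bar> < e"
    and unif_dt: "t \<in> {0..<T} \<Longrightarrow> e > 0 \<Longrightarrow>
      \<forall>\<^sub>F r in at t within {0..<T}. \<forall>x. \<bar>(u r x - u t x) / (r - t) - ut t x\<bar> < e"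
    and eq: "t \<in> {0..<T} \<Longrightarrow> ut t x + c * u t x ^ p * ux t x =
      - deriv (helmholtz_inverse (\<lambda>y. A * u t y ^ (p - 1) * (ux t y)\<^sup>2 + B * u t y ^ (p + 1))) x"
begin

definition F :: "real \<Rightarrow> real \<Rightarrow> real" where
  "F t x = A * u t x ^ (p - 1) * (ux t x)\<^sup>2 + B * u t x ^ (p + 1)"

definition G :: "real \<Rightarrow> real \<Rightarrow> real" where
  "G t = helmholtz_inverse (F t)"

lemma per_ux: "t \<in> {0..<T} \<Longrightarrow> ux t (x + 1) = ux t x"
  using deriv_periodic[OF dx per] .

lemma cont_u: "t \<in> {0..<T} \<Longrightarrow> continuous_on UNIV (u t)"
  by (rule DERIV_continuous_on[OF has_field_derivative_at_within[OF dx]])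

lemma helmholtz_solution_G:
  assumes "t \<in> {0..<T}"
  shows "helmholtz_solution (F t) (G t)"
  unfolding G_def
proof (rule helmholtz_inverse)
  show "continuous_on UNIV (F t)"
    unfolding F_def by (intro continuous_intros cont_u cont_ux assms)
  show "periodic_fun_simple' (F t)"
    by unfold_locales (simp add: F_def per[OF assms] per_ux[OF assms])
qed

lemma ut_eq:
  assumes "t \<in> {0..<T}"
  shows "ut t x = - (c * u t x ^ p * ux t x) - deriv (G t) x"
  using eq[OF assms, of x] unfolding G_def F_def[abs_def] by linarith

lemma dt:
  assumes "t \<in> {0..<T}"
  shows "((\<lambda>r. u r x) has_real_derivative ut t x) (at t within {0..<T})"
  by (rule has_real_derivative_of_uniform_quotient) (auto elim: eventually_mono[OF unif_dt[OF assms]])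

lemma joint_cont_u: "continuous_on ({0..<T} \<times> UNIV) (\<lambda>(t, x). u t x)"
proof (rule continuous_on_joint[OF cont_u])
  fix t e R :: real assume "t \<in> {0..<T}" "e > 0"
  then show "\<forall>\<^sub>F r in at t within {0..<T}. \<forall>x. \<bar>x\<bar> \<le> R \<longrightarrow> \<bar>u r x - u t x\<bar> < e"
    by (rule eventually_mono[OF unif]) blast
qed

lemma joint_cont_ux: "continuous_on ({0..<T} \<times> UNIV) (\<lambda>(t, x). ux t x)"
proof (rule continuous_on_joint[OF cont_ux])
  fix t e R :: real assume "t \<in> {0..<T}" "e > 0"
  then show "\<forall>\<^sub>F r in at t within {0..<T}. \<forall>x. \<bar>x\<bar> \<le> R \<longrightarrow> \<bar>ux r x - ux t x\<bar> < e"
    by (rule eventually_mono[OF unif]) blast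
qed

section \<open>Propagation of the zero solution in time\<close>

lemma abs_F_le:
  assumes "\<bar>u t x\<bar> \<le> M" "\<bar>ux t x\<bar> \<le> M" "M \<le> 1"
  shows "\<bar>F t x\<bar> \<le> (\<bar>A\<bar> + \<bar>B\<bar>) * M"
proof -
  have M: "M \<ge> 0" using assms(1) by linarith
  \<comment> \<open>As \<open>M \<le> 1\<close>, surplus powers are bounded by 1. What remains is
    linear in \<open>M\<close>, so that one time window serves for bounds of every size.\<close>
  have pw: "\<bar>u t x\<bar> ^ n \<le> 1" for n using assms by (intro power_le_one) auto
  have "(ux t x)\<^sup>2 = \<bar>ux t x\<bar> * \<bar>ux t x\<bar>" by (simp add: power2_eq_square)
  also have "\<dots> \<le> M * 1" using assms M by (intro mult_mono) auto
  finally have "\<bar>u t x\<bar> ^ (p - 1) * (ux t x)\<^sup>2 \<le> 1 * M" using pw M by (intro mult_mono) auto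
  then have 1: "\<bar>A\<bar> * (\<bar>u t x\<bar> ^ (p - 1) * (ux t x)\<^sup>2) \<le> \<bar>A\<bar> * M" by (simp add: mult_left_mono)
  have "\<bar>u t x\<bar> * \<bar>u t x\<bar> ^ p \<le> M * 1" using assms pw M by (intro mult_mono) auto
  then have 2: "\<bar>B\<bar> * \<bar>u t x\<bar> ^ (p + 1) \<le> \<bar>B\<bar> * M" by (simp add: mult_left_mono)
  have "\<bar>F t x\<bar> \<le> \<bar>A * u t x ^ (p - 1) * (ux t x)\<^sup>2\<bar> + \<bar>B * u t x ^ (p + 1)\<bar>"
    unfolding F_def by (rule abs_triangle_ineq)
  also have "\<dots> = \<bar>A\<bar> * (\<bar>u t x\<bar> ^ (p - 1) * (ux t x)\<^sup>2) + \<bar>B\<bar> * \<bar>u t x\<bar> ^ (p + 1)"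
    by (simp add: abs_mult power_abs)
  also have "\<dots> \<le> (\<bar>A\<bar> + \<bar>B\<bar>) * M" using 1 2 by (simp add: distrib_right)
  finally show ?thesis .
qed

lemma speed_lipschitz:
  assumes t: "t \<in> {0..<T}" and M: "\<And>z. \<bar>u t z\<bar> \<le> M" "\<And>z. \<bar>ux t z\<bar> \<le> M"
  shows "\<bar>c * u t y ^ p - c * u t x ^ p\<bar> \<le> \<bar>c\<bar> * real p * M ^ p * \<bar>y - x\<bar>"
proof (rule abs_diff_le_of_DERIV[where S = UNIV])
  fix z
  show "((\<lambda>z. c * u t z ^ p) has_real_derivative c * (real p * u t z ^ (p - 1) * ux t z)) (at z within UNIV)"
    using dx[OF t] by (auto intro!: derivative_eq_intros)
  have M0: "M \<ge> 0" using M(1)[of z] by linarith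
  have "\<bar>u t z\<bar> ^ (p - 1) * \<bar>ux t z\<bar> \<le> M ^ (p - 1) * M"
    using M M0 by (intro mult_mono power_mono) auto
  also have "\<dots> = M ^ p" using p_pos by (cases p) auto
  finally have "\<bar>c\<bar> * real p * (\<bar>u t z\<bar> ^ (p - 1) * \<bar>ux t z\<bar>) \<le> \<bar>c\<bar> * real p * M ^ p"
    by (intro mult_left_mono) auto
  then show "\<bar>c * (real p * u t z ^ (p - 1) * ux t z)\<bar> \<le> \<bar>c\<bar> * real p * M ^ p"
    by (simp add: abs_mult power_abs mult.assoc)
qed auto

text \<open>From zero data at \<open>t0\<close>, integrate over times within \<delta>: |u_t| is at
  most (|c| + 2(|A| + |B|)) M, and u_x is controlled by \<open>transport_comparison\<close> with
  source slope 2(|A| + |B|) M and speed slope |c| p. The conditions on \<delta> make both results at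
  most M/2 and do not involve \<open>M\<close>, so the argument can be repeated on the same
  window.\<close>

lemma halving:
  assumes t0: "t0 \<in> {0..<T}" and zero: "\<And>x. u t0 x = 0"
    and \<delta>: "\<delta> \<le> 1" "\<delta> * (\<bar>c\<bar> + 2 * (\<bar>A\<bar> + \<bar>B\<bar>)) \<le> 1 / 2"
      "\<delta> * (2 * (\<bar>A\<bar> + \<bar>B\<bar>) * exp (\<bar>c\<bar> * real p)) \<le> 1 / 2"
    and M: "M \<le> 1"
    and bound: "\<And>t x. t \<in> {0..<T} \<Longrightarrow> \<bar>t - t0\<bar> \<le> \<delta> \<Longrightarrow> \<bar>u t x\<bar> \<le> M \<and> \<bar>ux t x\<bar> \<le> M"
    and t: "t \<in> {0..<T}" "\<bar>t - t0\<bar> \<le> \<delta>"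
  shows "\<bar>u t x\<bar> \<le> M / 2 \<and> \<bar>ux t x\<bar> \<le> M / 2"
proof -
  define W where "W = {0..<T} \<inter> {t0 - \<delta>..t0 + \<delta>}"
  have W: "r \<in> W \<longleftrightarrow> r \<in> {0..<T} \<and> \<bar>r - t0\<bar> \<le> \<delta>" for r by (auto simp: W_def)
  have "\<delta> \<ge> 0" using t(2) by linarith
  have M0: "M \<ge> 0" using bound[OF t, of x] by linarith
  define C where "C = 2 * (\<bar>A\<bar> + \<bar>B\<bar>)"
  have C0: "C \<ge> 0" by (simp add: C_def)
  have G: "\<bar>deriv (G r) z\<bar> \<le> C * M" "\<bar>deriv (G r) y - deriv (G r) z\<bar> \<le> C * M * \<bar>y - z\<bar>"
    if "r \<in> W" for r y z
  proof -
    have bF: "\<bar>F r z\<bar> \<le> (\<bar>A\<bar> + \<bar>B\<bar>) * M" for z using abs_F_le bound that M W by blast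
    have hs: "helmholtz_solution (F r) (G r)" using that W by (intro helmholtz_solution_G) simp
    have e: "2 * ((\<bar>A\<bar> + \<bar>B\<bar>) * M) = C * M" by (simp add: C_def)
    show "\<bar>deriv (G r) z\<bar> \<le> C * M" "\<bar>deriv (G r) y - deriv (G r) z\<bar> \<le> C * M * \<bar>y - z\<bar>"
      using helmholtz_bounds(2,3)[OF hs bF] unfolding e by blast+
  qed
  have pw: "\<bar>u r z\<bar> ^ n \<le> 1" if "r \<in> W" for r z n
    using bound[of r z] that M W by (intro power_le_one) auto
  have "\<bar>u t x - u t0 x\<bar> \<le> (\<bar>c\<bar> + C) * M * \<bar>t - t0\<bar>"
  proof (rule abs_diff_le_of_DERIV[where S = W])
    fix r assume r: "r \<in> W"
    then have rI: "r \<in> {0..<T}" by (simp add: W)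
    show "((\<lambda>r. u r x) has_real_derivative ut r x) (at r within W)"
      by (rule has_field_derivative_subset[OF dt[OF rI]]) (auto simp: W_def)
    have "\<bar>u r x\<bar> ^ p * \<bar>ux r x\<bar> \<le> 1 * M"
      using pw[OF r, of x p] bound[OF rI, of x] r by (intro mult_mono) (auto simp: W)
    then have "\<bar>c\<bar> * (\<bar>u r x\<bar> ^ p * \<bar>ux r x\<bar>) \<le> \<bar>c\<bar> * M" by (simp add: mult_left_mono)
    then have "\<bar>c * u r x ^ p * ux r x\<bar> \<le> \<bar>c\<bar> * M" by (simp add: abs_mult power_abs mult.assoc)
    then show "\<bar>ut r x\<bar> \<le> (\<bar>c\<bar> + C) * M"
      using G(1)[OF r, of x] unfolding ut_eq[OF rI] by (simp add: distrib_right)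
  next
    show "convex W" unfolding W_def by (intro convex_Int) auto
  qed (use t t0 \<open>\<delta> \<ge> 0\<close> W in auto)
  also have "\<dots> \<le> (\<bar>c\<bar> + C) * M * \<delta>" using t(2) M0 C0 by (intro mult_left_mono) auto
  also have "\<dots> = (\<delta> * (\<bar>c\<bar> + C)) * M" by simp
  also have "\<dots> \<le> 1 / 2 * M" using \<delta>(2) M0 unfolding C_def by (intro mult_right_mono) auto
  finally have 1: "\<bar>u t x\<bar> \<le> M / 2" using zero by simp
  \<comment> \<open>The direction of time: \<sigma> = -1 runs the equation backwards from
    \<open>t0\<close>, which merely reverses the signs of speed and source, so earlier times need no
    separate argument.\<close>
  define \<sigma> :: real where "\<sigma> = (if t \<ge> t0 then 1 else -1)"
  define d where "d = \<bar>t - t0\<bar>"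
  have \<sigma>: "t0 + \<sigma> * d = t" "\<bar>\<sigma>\<bar> = 1" by (auto simp: \<sigma>_def d_def)
  have in_W: "t0 + \<sigma> * r \<in> W" if "r \<in> {0..d}" for r
    using that t t0 unfolding W_def \<sigma>_def d_def by (auto split: if_splits)
  \<comment> \<open>The comparison bounds slopes from above only; \<rho> = 1 and \<rho> = -1
    together bound |u_x|.\<close>
  have 2: "\<rho> * ux t x \<le> M / 2" if \<rho>: "\<bar>\<rho>\<bar> = 1" for \<rho> :: real
  proof -
    have cmp: "\<rho> * u t y - \<rho> * u t x \<le> C * M * d * exp (\<bar>c\<bar> * real p * d) * (y - x)"
      if xy: "x \<le> y" "y \<le> x + 1" for y
    proof -
      define f where "f r z = \<rho> * u (t0 + \<sigma> * r) z" for r z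
      have "f d y - f d x \<le> C * M * d * exp (\<bar>c\<bar> * real p * d) * (y - x)"
      proof (rule transport_comparison[where \<delta> = d
            and ft = "\<lambda>r z. \<rho> * (\<sigma> * ut (t0 + \<sigma> * r) z)" and fx = "\<lambda>r z. \<rho> * ux (t0 + \<sigma> * r) z"
            and a = "\<lambda>r z. \<sigma> * (c * u (t0 + \<sigma> * r) z ^ p)"
            and H = "\<lambda>r z. - (\<rho> * \<sigma> * deriv (G (t0 + \<sigma> * r)) z)" and \<kappa> = "\<lambda>_. 0"])
        have "continuous_on ({0..d} \<times> UNIV) (\<lambda>w. \<rho> * (\<lambda>(t, x). u t x) (t0 + \<sigma> * fst w, snd w))"
          by (intro continuous_intros continuous_on_compose2[OF joint_cont_u])
             (use in_W in \<open>auto simp: W\<close>)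
        then show "continuous_on ({0..d} \<times> UNIV) (\<lambda>(t, x). f t x)"
          by (simp add: f_def case_prod_beta)
      next
        fix r z assume r: "r \<in> {0..d}"
        then have I: "t0 + \<sigma> * r \<in> {0..<T}" using in_W W by blast
        have "((\<lambda>r. u (t0 + \<sigma> * r) z) has_real_derivative ut (t0 + \<sigma> * r) z * \<sigma>) (at r within {0..d})"
        proof (rule DERIV_image_chain[where f = "\<lambda>r. u r z" and g = "\<lambda>r. t0 + \<sigma> * r", unfolded o_def])
          show "((\<lambda>r. u r z) has_real_derivative ut (t0 + \<sigma> * r) z)
              (at (t0 + \<sigma> * r) within (\<lambda>r. t0 + \<sigma> * r) ` {0..d})"
            by (rule has_field_derivative_subset[OF dt[OF I]]) (use in_W W in blast)
          show "((\<lambda>r. t0 + \<sigma> * r) has_real_derivative \<sigma>) (at r within {0..d})"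
            by (auto intro!: derivative_eq_intros)
        qed
        from DERIV_cmult[OF this, of \<rho>]
        show "((\<lambda>r. f r z) has_real_derivative \<rho> * (\<sigma> * ut (t0 + \<sigma> * r) z)) (at r within {0..d})"
          by (simp add: f_def mult.commute)
        show "(f r has_real_derivative \<rho> * ux (t0 + \<sigma> * r) z) (at z)"
          unfolding f_def by (rule DERIV_cmult[OF dx[OF I]])
        show "\<rho> * (\<sigma> * ut (t0 + \<sigma> * r) z) + \<sigma> * (c * u (t0 + \<sigma> * r) z ^ p) * (\<rho> * ux (t0 + \<sigma> * r) z) =
            - (\<rho> * \<sigma> * deriv (G (t0 + \<sigma> * r)) z)"
          unfolding ut_eq[OF I] by (simp add: algebra_simps)
        show "f r (z + 1) = f r z + 0" by (simp add: f_def per[OF I])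
      next
        fix r z y assume r: "r \<in> {0..d}" and zy: "z \<le> (y::real)"
        note rW = in_W[OF r]
        then have I: "t0 + \<sigma> * r \<in> {0..<T}" using W by blast
        have "- (\<rho> * \<sigma> * deriv (G (t0 + \<sigma> * r)) y) - - (\<rho> * \<sigma> * deriv (G (t0 + \<sigma> * r)) z)
            \<le> \<bar>- (\<rho> * \<sigma> * deriv (G (t0 + \<sigma> * r)) y) - - (\<rho> * \<sigma> * deriv (G (t0 + \<sigma> * r)) z)\<bar>" by (rule abs_ge_self)
        also have "\<dots> = \<bar>\<rho> * \<sigma> * (deriv (G (t0 + \<sigma> * r)) z - deriv (G (t0 + \<sigma> * r)) y)\<bar>"
          by (simp add: algebra_simps)
        also have "\<dots> = \<bar>deriv (G (t0 + \<sigma> * r)) z - deriv (G (t0 + \<sigma> * r)) y\<bar>"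
          using \<rho> \<sigma>(2) by (simp add: abs_mult)
        also have "\<dots> \<le> C * M * \<bar>z - y\<bar>" by (rule G(2)[OF rW])
        finally show "- (\<rho> * \<sigma> * deriv (G (t0 + \<sigma> * r)) y) - - (\<rho> * \<sigma> * deriv (G (t0 + \<sigma> * r)) z)
            \<le> C * M * (y - z)" using zy by simp
        have "\<sigma> * (c * u (t0 + \<sigma> * r) z ^ p) - \<sigma> * (c * u (t0 + \<sigma> * r) y ^ p)
            \<le> \<bar>\<sigma> * (c * u (t0 + \<sigma> * r) z ^ p - c * u (t0 + \<sigma> * r) y ^ p)\<bar>"
          by (simp only: right_diff_distrib abs_ge_self)
        also have "\<dots> = \<bar>c * u (t0 + \<sigma> * r) z ^ p - c * u (t0 + \<sigma> * r) y ^ p\<bar>"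
          using \<sigma>(2) by (simp only: abs_mult) simp
        \<comment> \<open>The bound 1 replaces \<open>M\<close>, so that the exponential factor does
          not depend on \<open>M\<close>.\<close>
        also have "\<dots> \<le> \<bar>c\<bar> * real p * 1 ^ p * \<bar>z - y\<bar>"
        proof (rule speed_lipschitz[OF I])
          fix z
          have "\<bar>u (t0 + \<sigma> * r) z\<bar> \<le> M \<and> \<bar>ux (t0 + \<sigma> * r) z\<bar> \<le> M" using bound rW W by blast
          then show "\<bar>u (t0 + \<sigma> * r) z\<bar> \<le> 1" "\<bar>ux (t0 + \<sigma> * r) z\<bar> \<le> 1" using M by linarith+
        qed
        finally show "\<sigma> * (c * u (t0 + \<sigma> * r) z ^ p) - \<sigma> * (c * u (t0 + \<sigma> * r) y ^ p)
            \<le> \<bar>c\<bar> * real p * (y - z)" using zy by simp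
      qed (use M0 C0 xy zero in \<open>auto simp: f_def d_def\<close>)
      then show ?thesis by (simp add: f_def \<sigma>(1))
    qed
    have "((\<lambda>z. \<rho> * u t z) has_real_derivative \<rho> * ux t x) (at x)" by (rule DERIV_cmult[OF dx[OF t(1)]])
    from DERIV_le_of_right_slopes[OF this cmp]
    have "\<rho> * ux t x \<le> C * M * d * exp (\<bar>c\<bar> * real p * d)" .
    also have "\<dots> \<le> C * M * \<delta> * exp (\<bar>c\<bar> * real p * 1)"
      using t(2) \<delta>(1) C0 M0 \<open>\<delta> \<ge> 0\<close> unfolding d_def[symmetric]
      by (intro mult_mono mult_nonneg_nonneg iffD2[OF exp_le_cancel_iff]) (auto simp: d_def)
    also have "\<dots> = (\<delta> * (C * exp (\<bar>c\<bar> * real p))) * M" by simp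
    also have "\<dots> \<le> 1 / 2 * M" using \<delta>(3) M0 unfolding C_def by (intro mult_right_mono) auto
    finally show ?thesis by simp
  qed
  show ?thesis using 1 2[of 1] 2[of "-1"] by (simp add: abs_le_iff)
qed

text \<open>Continuity in time gives the bound 1 on a window around \<open>t0\<close>; halving it
  again and again on that same window leaves only 0.\<close>

lemma zero_nearby:
  assumes t0: "t0 \<in> {0..<T}" and zero: "\<And>x. u t0 x = 0"
  shows "\<exists>\<delta>>0. \<forall>t\<in>{0..<T}. \<bar>t - t0\<bar> \<le> \<delta> \<longrightarrow> (\<forall>x. u t x = 0)"
proof -
  have ux0: "ux t0 x = 0" for x
  proof -
    have "u t0 = (\<lambda>x. 0)" using zero by blast
    then show ?thesis using dx[OF t0, of x] DERIV_unique[OF _ DERIV_const] by metis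
  qed
  obtain d where d: "d > 0" "\<forall>t\<in>{0..<T}. t \<noteq> t0 \<and> dist t t0 < d \<longrightarrow> (\<forall>x. \<bar>u t x\<bar> < 1 \<and> \<bar>ux t x\<bar> < 1)"
    using unif[OF t0, of 1] unfolding eventually_at by (auto simp: zero ux0)
  \<comment> \<open>The sum of all constants to be beaten, so that the single inequality \<delta> C
    \<le> 1/2 yields every condition; the summand 1 secures \<delta> \<le> 1.\<close>
  define C where "C = \<bar>c\<bar> + 2 * (\<bar>A\<bar> + \<bar>B\<bar>) + 2 * (\<bar>A\<bar> + \<bar>B\<bar>) * exp (\<bar>c\<bar> * real p) + 1"
  have C: "C \<ge> 1" by (simp add: C_def)
  define \<delta> where "\<delta> = min (d / 2) (1 / (2 * C))"
  have \<delta>0: "\<delta> > 0" using d C by (simp add: \<delta>_def)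
  have "\<delta> * C \<le> 1 / (2 * C) * C" unfolding \<delta>_def using C by (intro mult_right_mono) auto
  then have "\<delta> * C \<le> 1 / 2" using C by simp
  have le: "\<delta> * k \<le> 1 / 2" if "k \<le> C" for k
    using mult_left_mono[OF that, of \<delta>] \<delta>0 \<open>\<delta> * C \<le> 1 / 2\<close> by linarith
  have e0: "0 \<le> 2 * (\<bar>A\<bar> + \<bar>B\<bar>) * exp (\<bar>c\<bar> * real p)" by simp
  have \<delta>: "\<delta> \<le> 1" "\<delta> * (\<bar>c\<bar> + 2 * (\<bar>A\<bar> + \<bar>B\<bar>)) \<le> 1 / 2"
      "\<delta> * (2 * (\<bar>A\<bar> + \<bar>B\<bar>) * exp (\<bar>c\<bar> * real p)) \<le> 1 / 2"
    using le[of 1] C by simp (rule le, use e0 in \<open>simp add: C_def\<close>)+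
  have "\<forall>t x. t \<in> {0..<T} \<longrightarrow> \<bar>t - t0\<bar> \<le> \<delta> \<longrightarrow> \<bar>u t x\<bar> \<le> (1 / 2) ^ n \<and> \<bar>ux t x\<bar> \<le> (1 / 2) ^ n" for n
  proof (induction n)
    case 0
    have "\<bar>u t x\<bar> \<le> 1 \<and> \<bar>ux t x\<bar> \<le> 1" if "t \<in> {0..<T}" "\<bar>t - t0\<bar> \<le> \<delta>" for t x
    proof (cases "t = t0")
      case False
      have "dist t t0 < d" using that(2) d(1) by (simp add: dist_real_def \<delta>_def)
      then show ?thesis using d(2) that(1) False by (simp add: less_imp_le)
    qed (simp add: zero ux0)
    then show ?case by simp
  next
    case (Suc n)
    have "\<bar>u t x\<bar> \<le> (1 / 2) ^ n / 2 \<and> \<bar>ux t x\<bar> \<le> (1 / 2) ^ n / 2"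
      if "t \<in> {0..<T}" "\<bar>t - t0\<bar> \<le> \<delta>" for t x
      using Suc by (intro halving[OF t0 zero \<delta> _ _ that]) (auto simp: power_le_one)
    then show ?case by simp
  qed
  note small = this
  have "u t x = 0" if "t \<in> {0..<T}" "\<bar>t - t0\<bar> \<le> \<delta>" for t x
  proof -
    have "(\<lambda>n. (1 / 2 :: real) ^ n) \<longlonglongrightarrow> 0" by (rule LIMSEQ_power_zero) simp
    then have "\<bar>u t x\<bar> \<le> 0" by (rule LIMSEQ_le_const) (use small that in blast)
    then show ?thesis by simp
  qed
  then show ?thesis using \<delta>0 by blast
qed

text \<open>The times at which the solution vanishes form a subset of [0,T) that is open by
  \<open>zero_nearby\<close> and closed by continuity; connectedness does the rest on both sides of
  \<open>t0\<close>.\<close>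

theorem zero_everywhere:
  assumes t0: "t0 \<in> {0..<T}" and zero: "\<And>x. u t0 x = 0" and t: "t \<in> {0..<T}"
  shows "u t x = 0"
proof -
  define P where "P t \<longleftrightarrow> (\<forall>x. u t x = 0)" for t
  have "P t"
  proof (rule connected_induction_simple[where S = "{0..<T}" and P = P and a = t0 and b = t])
    fix r assume r: "r \<in> {0..<T}"
    obtain d where d: "d > 0" "(\<forall>s\<in>{0..<T}. \<bar>s - r\<bar> < d \<longrightarrow> P s) \<or> (\<forall>s\<in>{0..<T}. \<bar>s - r\<bar> < d \<longrightarrow> \<not> P s)"
    proof (cases "P r")
      case True
      then obtain \<delta> where "\<delta> > 0" "\<forall>t\<in>{0..<T}. \<bar>t - r\<bar> \<le> \<delta> \<longrightarrow> (\<forall>x. u t x = 0)"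
        using zero_nearby[OF r] by (auto simp: P_def)
      then show ?thesis using that[of \<delta>] by (simp add: P_def)
    next
      case False
      then obtain x where x: "u r x \<noteq> 0" by (auto simp: P_def)
      then obtain d where d: "d > 0" "\<forall>s\<in>{0..<T}. s \<noteq> r \<and> dist s r < d \<longrightarrow> (\<forall>x'. \<bar>u s x' - u r x'\<bar> < \<bar>u r x\<bar> \<and> \<bar>ux s x' - ux r x'\<bar> < \<bar>u r x\<bar>)"
        using unif[OF r, of "\<bar>u r x\<bar>"] unfolding eventually_at by auto
      have "\<not> P s" if "s \<in> {0..<T}" "\<bar>s - r\<bar> < d" for s
      proof (cases "s = r")
        case False
        then have "\<bar>u s x - u r x\<bar> < \<bar>u r x\<bar>" using d(2) that by (simp add: dist_real_def)
        then show ?thesis unfolding P_def by force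
      qed (use False in simp)
      then show ?thesis using that[of d] d(1) by blast
    qed
    show "\<exists>V. openin (top_of_set {0..<T}) V \<and> r \<in> V \<and> (\<forall>x\<in>V. \<forall>y\<in>V. P x \<longrightarrow> P y)"
    proof (intro exI conjI)
      show "openin (top_of_set {0..<T}) ({0..<T} \<inter> ball r d)" by (intro openin_open_Int) simp
      show "r \<in> {0..<T} \<inter> ball r d" using r d(1) by simp
      show "\<forall>x\<in>{0..<T} \<inter> ball r d. \<forall>y\<in>{0..<T} \<inter> ball r d. P x \<longrightarrow> P y"
        using d(2) by (auto simp: dist_real_def abs_minus_commute)
    qed
  qed (use t0 t zero in \<open>auto simp: P_def\<close>)
  then show ?thesis by (simp add: P_def)
qed

end

section \<open>Vanishing of the nonlinearity and persistence of the sign\<close>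

lemma periodic_jointly_continuous_bounded:
  fixes f :: "real \<Rightarrow> real \<Rightarrow> real"
  assumes cont: "continuous_on (K \<times> UNIV) (\<lambda>(t, x). f t x)" and "compact K"
    and per: "\<And>t x. t \<in> K \<Longrightarrow> f t (x + 1) = f t x"
  obtains M where "\<And>t x. t \<in> K \<Longrightarrow> \<bar>f t x\<bar> \<le> M"
proof -
  have "continuous_on (K \<times> {0..1}) (\<lambda>(t, x). f t x)" by (rule continuous_on_subset[OF cont]) auto
  then have "bounded ((\<lambda>(t, x). f t x) ` (K \<times> {0..1}))"
    by (intro compact_imp_bounded compact_continuous_image compact_Times \<open>compact K\<close>) auto
  then obtain M where M: "\<And>y. y \<in> (\<lambda>(t, x). f t x) ` (K \<times> {0..1}) \<Longrightarrow> norm y \<le> M"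
    unfolding bounded_iff by blast
  show ?thesis
  proof
    fix t x :: real assume t: "t \<in> K"
    interpret periodic_fun_simple' "f t" by unfold_locales (rule per[OF t])
    have "frac x \<in> {0..1}" using frac_lt_1[of x] by auto
    then have "f t (frac x) \<in> (\<lambda>(t, x). f t x) ` (K \<times> {0..1})" using t by force
    moreover have "f t (frac x) = f t x"
      using plus_of_int[of "frac x" "\<lfloor>x\<rfloor>"] by (simp add: frac_def)
    ultimately show "\<bar>f t x\<bar> \<le> M" using M[of "f t x"] by simp
  qed
qed

context classical_solution
begin

lemma F_eq_0:
  assumes t: "t \<in> {0..<T}"
    and sign: "(\<forall>x. F t x \<ge> 0) \<or> (\<forall>x. F t x \<le> 0)"
    and ab: "\<alpha> < \<beta>" and u0: "\<And>x. x \<in> {\<alpha>..\<beta>} \<Longrightarrow> u t x = 0"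
    and ut0: "ut t \<alpha> = 0" "ut t \<beta> = 0"
  shows "F t x = 0"
proof -
  note G = helmholtz_solution_G[OF t]
  have F0: "F t x = 0" if "\<alpha> < x" "x < \<beta>" for x
  proof -
    have "ux t x = 0"
    proof (rule DERIV_local_const[OF dx[OF t]])
      show "0 < min (x - \<alpha>) (\<beta> - x)" using that by simp
      show "\<forall>y. \<bar>x - y\<bar> < min (x - \<alpha>) (\<beta> - x) \<longrightarrow> u t x = u t y"
        using that by (auto simp: u0 abs_less_iff)
    qed
    then show ?thesis using u0[of x] that by (simp add: F_def)
  qed
  \<comment> \<open>At the endpoints u = 0 removes the transport term because p > 0, so u_t = 0
    there means G' = 0.\<close>
  have d0: "deriv (G t) \<alpha> = 0" "deriv (G t) \<beta> = 0"
    using ut_eq[OF t, of \<alpha>] ut_eq[OF t, of \<beta>] u0[of \<alpha>] u0[of \<beta>] ab ut0 zero_power[OF p_pos, where 'a = real] by simp_all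
  show ?thesis
    using sign
  proof
    assume "\<forall>x. F t x \<ge> 0"
    then show ?thesis by (intro helmholtz_unique_continuation[OF G _ ab F0 d0]) auto
  next
    assume *: "\<forall>x. F t x \<le> 0"
    have d: "deriv (\<lambda>x. - G t x) x = - deriv (G t) x" for x
      by (intro DERIV_imp_deriv DERIV_minus helmholtz_solutionD[OF G])
    have "- F t x = 0"
      by (rule helmholtz_unique_continuation[OF helmholtz_solution_uminus[OF G] _ ab])
         (use * F0 d0 d in auto)
    then show ?thesis by simp
  qed
qed

text \<open>For these coefficients the momentum \<open>m\<close> obeys the continuity equation \<open>m\<^sub>t + c (u^p m)\<^sub>x = 0\<close>,
  so a primitive of \<open>m\<close> is transported with speed \<open>c u^p\<close>, up to a function of time, and its
  monotonicity persists. The primitive \<open>U - u\<^sub>x\<close> is used because \<open>m\<close> has no time derivative.\<close>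

lemma sign_preserved:
  assumes A: "A = real p * c" and B: "B = real p * c / (real p + 1)"
    and dxx: "\<And>t x. t \<in> {0..<T} \<Longrightarrow> (ux t has_real_derivative uxx t x) (at x)"
    and dtx: "\<And>t x. t \<in> {0..<T} \<Longrightarrow> ((\<lambda>r. ux r x) has_real_derivative utx t x) (at t within {0..<T})"
    and dxt: "\<And>t x. t \<in> {0..<T} \<Longrightarrow> (ut t has_real_derivative utx t x) (at x)"
    and init: "\<And>x. \<sigma> * (u 0 x - uxx 0 x) \<ge> 0"
    and t1: "t1 \<in> {0..<T}"
  shows "\<sigma> * u t1 x \<ge> 0"
proof -
  define U where "U t = (SOME V. (\<forall>x. (V has_real_derivative u t x) (at x)) \<and> V 0 = 0)" for t
  have U: "(U t has_real_derivative u t x) (at x)" "U t 0 = 0" if tI: "t \<in> {0..<T}" for t x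
  proof -
    obtain V where "\<And>x. (V has_real_derivative u t x) (at x)" "V 0 = 0"
      using real_antiderivative[OF cont_u[OF tI]] by blast
    then have "\<exists>V. (\<forall>x. (V has_real_derivative u t x) (at x)) \<and> V 0 = 0" by blast
    from someI_ex[OF this] show "(U t has_real_derivative u t x) (at x)" "U t 0 = 0"
      unfolding U_def by auto
  qed
  \<comment> \<open>The integral of u_t from 0 to x in closed form, since u_t is minus the
    x-derivative of c u^(p+1)/(p+1) + G. Subtracting the values at 0 matches the normalisation
    \<open>U t 0 = 0\<close>.\<close>
  define W where "W t x = - (c / real (p + 1)) * (u t x ^ (p + 1) - u t 0 ^ (p + 1)) - (G t x - G t 0)" for t x
  have dW: "(W t has_real_derivative ut t x) (at x)" if t: "t \<in> {0..<T}" for t x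
  proof -
    have "((\<lambda>x. u t x ^ (p + 1)) has_real_derivative real (p + 1) * u t x ^ p * ux t x) (at x)"
      using DERIV_power[OF dx[OF t], of "p + 1" x] by (simp add: ac_simps)
    from DERIV_diff[OF DERIV_cmult[OF DERIV_diff[OF this DERIV_const]]
        DERIV_diff[OF helmholtz_solutionD(1)[OF helmholtz_solution_G[OF t]] DERIV_const]]
    have "(W t has_real_derivative
        - (c / real (p + 1)) * (real (p + 1) * u t x ^ p * ux t x - 0) - (deriv (G t) x - 0)) (at x)"
      unfolding W_def[abs_def] .
    moreover have "- (c / real (p + 1)) * (real (p + 1) * u t x ^ p * ux t x - 0) - (deriv (G t) x - 0) = ut t x"
      unfolding ut_eq[OF t] by (simp del: of_nat_Suc of_nat_add)
    ultimately show ?thesis by simp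
  qed
  have U_diff: "\<bar>U r x - U t x\<bar> \<le> e * \<bar>x\<bar>"
    if "r \<in> {0..<T}" "t \<in> {0..<T}" "\<And>x. \<bar>u r x - u t x\<bar> \<le> e" for r t x e
    using abs_diff_le_of_DERIV[of UNIV "\<lambda>x. U r x - U t x" "\<lambda>x. u r x - u t x" e 0 x]
      DERIV_diff[OF U(1)[OF that(1)] U(1)[OF that(2)]] U(2) that by simp
  have inI: "\<forall>\<^sub>F r in at t within {0..<T}. r \<in> {0..<T} \<and> r \<noteq> t" for t
    by (simp add: eventually_at_filter)
  have scale: "e / (\<bar>x\<bar> + 1) > 0" "e / (\<bar>x\<bar> + 1) * \<bar>x\<bar> < e" if "e > 0" for e x :: real
    using that by (auto simp: field_simps intro: divide_pos_pos add_nonneg_pos)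
  have U_dt: "((\<lambda>r. U r x) has_real_derivative W t x) (at t within {0..<T})" if t: "t \<in> {0..<T}" for t x
  proof (rule has_real_derivative_of_uniform_quotient)
    fix e :: real assume e: "e > 0"
    show "\<forall>\<^sub>F r in at t within {0..<T}. \<bar>(U r x - U t x) / (r - t) - W t x\<bar> < e"
      using unif_dt[OF t scale(1)[OF e, of x]] inI
    proof eventually_elim
      case (elim r)
      then have r: "r \<in> {0..<T}" by simp
      \<comment> \<open>The error of the difference quotient of \<open>U\<close> vanishes at 0, and
        its space derivative is the error for \<open>u\<close>, which is uniformly small.\<close>
      have "\<bar>((U r x - U t x) / (r - t) - W t x) - ((U r 0 - U t 0) / (r - t) - W t 0)\<bar> \<le> e / (\<bar>x\<bar> + 1) * \<bar>x - 0\<bar>"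
      proof (rule abs_diff_le_of_DERIV[where S = UNIV])
        fix y
        show "((\<lambda>x. (U r x - U t x) / (r - t) - W t x) has_real_derivative
            (u r y - u t y) / (r - t) - ut t y) (at y within UNIV)"
          by (intro DERIV_diff DERIV_cdivide U r t dW)
        show "\<bar>(u r y - u t y) / (r - t) - ut t y\<bar> \<le> e / (\<bar>x\<bar> + 1)"
          using elim(1) by (simp add: less_imp_le)
      qed auto
      then have "\<bar>(U r x - U t x) / (r - t) - W t x\<bar> \<le> e / (\<bar>x\<bar> + 1) * \<bar>x\<bar>"
        using U(2)[OF r] U(2)[OF t] by (simp add: W_def)
      also have "\<dots> < e" by (rule scale(2)[OF e])
      finally show ?case .
    qed
  qed
  have shift_1: "U t (x + 1) = U t x + U t 1" if t: "t \<in> {0..<T}" for t x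
  proof -
    have "((\<lambda>x. U t (x + 1) - U t x) has_real_derivative 0) (at x)" for x
    proof -
      have "((\<lambda>x. U t (x + 1)) has_real_derivative u t (x + 1)) (at x)" using DERIV_shift U(1)[OF t] by blast
      from DERIV_diff[OF this U(1)[OF t]] show ?thesis by (simp add: per[OF t])
    qed
    then have "U t (x + 1) - U t x = U t (0 + 1) - U t 0" by (intro DERIV_isconst_all) blast
    then show ?thesis using U(2)[OF t] by simp
  qed
  have W1: "W t 1 = 0" if t: "t \<in> {0..<T}" for t
    using per[OF t, of 0] helmholtz_solutionD(3)[OF helmholtz_solution_G[OF t], of 0] by (simp add: W_def)
  have t0: "0 \<in> {0..<T}" using t1 by auto
  \<comment> \<open>Conservation of the mean of u, as \<open>W t 1 = 0\<close> by periodicity. The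
    increment of \<open>f\<close> over a period thus keeps the sign it has at time 0.\<close>
  have mean: "U t 1 = U 0 1" if t: "t \<in> {0..<T}" for t
  proof -
    have "\<exists>k. \<forall>t\<in>{0..<T}. U t 1 = k"
      by (rule has_field_derivative_zero_constant) (use U_dt[of _ 1] W1 in auto)
    then show ?thesis using t t0 by metis
  qed
  \<comment> \<open>The slope of \<open>f\<close> is -\<sigma> m, so the sign condition on m says
    that \<open>f\<close> is non-increasing, the form in which the comparison takes its initial
    data.\<close>
  define f where "f t x = - \<sigma> * (U t x - ux t x)" for t x
  have fx: "(f t has_real_derivative - \<sigma> * (u t x - uxx t x)) (at x)" if "t \<in> {0..<T}" for t x
    unfolding f_def[abs_def] by (intro DERIV_cmult DERIV_diff U dxx that)
  have f0: "f 0 y \<le> f 0 x" if "x \<le> y" for x y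
  proof (rule DERIV_nonpos_imp_nonincreasing[OF that])
    fix z
    have "- \<sigma> * (u 0 z - uxx 0 z) \<le> 0" using init[of z] by simp
    then show "\<exists>d. (f 0 has_real_derivative d) (at z) \<and> d \<le> 0" using fx[OF t0] by blast
  qed
  have f_shift: "f t (x + 1) = f t x + - \<sigma> * U t 1" if t: "t \<in> {0..<T}" for t x
    unfolding f_def shift_1[OF t, of x] per_ux[OF t, of x] by (simp add: algebra_simps)
  have neg: "- \<sigma> * U t 1 \<le> 0" if t: "t \<in> {0..<T}" for t
    using f_shift[OF t0, of 0] f0[of 0 1] mean[OF t] by simp
  have sub: "{0..t1} \<subseteq> {0..<T}" using t1 by auto
  obtain M1 where M1: "\<And>t x. t \<in> {0..t1} \<Longrightarrow> \<bar>u t x\<bar> \<le> M1"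
    using periodic_jointly_continuous_bounded[of "{0..t1}" u]
      continuous_on_subset[OF joint_cont_u] sub per by (metis Sigma_mono compact_Icc order_refl subset_iff)
  obtain M2 where M2: "\<And>t x. t \<in> {0..t1} \<Longrightarrow> \<bar>ux t x\<bar> \<le> M2"
    using periodic_jointly_continuous_bounded[of "{0..t1}" ux]
      continuous_on_subset[OF joint_cont_ux] sub per_ux by (metis Sigma_mono compact_Icc order_refl subset_iff)
  define M where "M = max M1 M2"
  have M: "\<bar>u t x\<bar> \<le> M" "\<bar>ux t x\<bar> \<le> M" if "t \<in> {0..t1}" for t x
    using M1[OF that, of x] M2[OF that, of x] by (auto simp: M_def)
  have M0: "M \<ge> 0" using M(1)[of 0 0] t1 by auto
  \<comment> \<open>The source \<open>H\<close> depends on time alone, so the comparison applies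
    with K = 0 and monotonicity persists without loss.\<close>
  have f_mono: "f t1 y - f t1 x \<le> 0 * t1 * exp (\<bar>c\<bar> * real p * M ^ p * t1) * (y - x)"
    if xy: "x \<le> y" "y \<le> x + 1" for x y
  proof (rule transport_comparison[where \<delta> = t1
      and ft = "\<lambda>t x. - \<sigma> * (W t x - utx t x)" and fx = "\<lambda>t x. - \<sigma> * (u t x - uxx t x)"
      and a = "\<lambda>t x. c * u t x ^ p" and \<kappa> = "\<lambda>t. - \<sigma> * U t 1"
      and H = "\<lambda>t x. - \<sigma> * (c / real (p + 1) * u t 0 ^ (p + 1) + G t 0)"])
    have "continuous_on ({0..<T} \<times> UNIV) (\<lambda>(t, x). U t x)"
    proof (rule continuous_on_joint)
      fix t assume "t \<in> {0..<T}"
      then show "continuous_on UNIV (U t)"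
        using DERIV_continuous_on[OF has_field_derivative_at_within[OF U(1)]] by blast
    next
      fix t e R :: real assume t: "t \<in> {0..<T}" and e: "e > 0"
      have "\<bar>y\<bar> < \<bar>R\<bar> + 1" if "\<bar>y\<bar> \<le> R" for y using that by linarith
      note y = this
      have "e / (\<bar>R\<bar> + 1) > 0" using e by (rule scale)
      from unif[OF t this] inI
      show "\<forall>\<^sub>F r in at t within {0..<T}. \<forall>x. \<bar>x\<bar> \<le> R \<longrightarrow> \<bar>U r x - U t x\<bar> < e"
      proof eventually_elim
        case (elim r)
        show ?case
        proof (intro allI impI)
          fix x assume x: "\<bar>x\<bar> \<le> R"
          have "\<bar>U r x - U t x\<bar> \<le> e / (\<bar>R\<bar> + 1) * \<bar>x\<bar>"
            by (rule U_diff) (use elim t in \<open>auto intro: less_imp_le\<close>)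
          also have "\<dots> < e / (\<bar>R\<bar> + 1) * (\<bar>R\<bar> + 1)"
            using y[OF x] scale(1)[OF e] by (intro mult_strict_left_mono) auto
          also have "\<dots> = e" by (simp add: add_nonneg_eq_0_iff)
          finally show "\<bar>U r x - U t x\<bar> < e" .
        qed
      qed
    qed
    from continuous_on_subset[OF this, of "{0..t1} \<times> UNIV"]
      continuous_on_subset[OF joint_cont_ux, of "{0..t1} \<times> UNIV"]
    show "continuous_on ({0..t1} \<times> UNIV) (\<lambda>(t, x). f t x)"
      using sub unfolding f_def case_prod_beta by (auto intro!: continuous_intros)
  next
    fix t x assume "t \<in> {0..t1}"
    then have t: "t \<in> {0..<T}" using sub by blast
    have "((\<lambda>r. f r x) has_real_derivative - \<sigma> * (W t x - utx t x)) (at t within {0..<T})"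
      unfolding f_def by (intro DERIV_cmult DERIV_diff U_dt dtx t)
    then show "((\<lambda>r. f r x) has_real_derivative - \<sigma> * (W t x - utx t x)) (at t within {0..t1})"
      by (rule has_field_derivative_subset[OF _ sub])
    show "(f t has_real_derivative - \<sigma> * (u t x - uxx t x)) (at x)" by (rule fx[OF t])
    show "f t (x + 1) = f t x + - \<sigma> * U t 1" by (rule f_shift[OF t])
    have utx: "utx t x = - (c * (real p * u t x ^ (p - 1) * (ux t x)\<^sup>2 + u t x ^ p * uxx t x)) - (G t x - F t x)"
    proof (rule DERIV_unique[OF dxt[OF t]])
      have e: "ut t = (\<lambda>x. - (c * u t x ^ p * ux t x) - deriv (G t) x)" using ut_eq[OF t] by blast
      have "((\<lambda>x. c * u t x ^ p * ux t x) has_real_derivative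
          c * (real p * u t x ^ (p - 1) * (ux t x)\<^sup>2 + u t x ^ p * uxx t x)) (at x)"
        by (rule derivative_eq_intros dx[OF t] dxx[OF t] refl | simp add: algebra_simps power2_eq_square)+
      then show "(ut t has_real_derivative - (c * (real p * u t x ^ (p - 1) * (ux t x)\<^sup>2 + u t x ^ p * uxx t x)) - (G t x - F t x)) (at x)"
        unfolding e by (intro DERIV_diff DERIV_minus helmholtz_solutionD(2)[OF helmholtz_solution_G[OF t]])
    qed
    \<comment> \<open>Together with A = pc this is where b = pc enters: F absorbs every x-dependent
      term left over, and only a function of time remains.\<close>
    have cB: "c - c / (real p + 1) = B" unfolding B by (simp add: field_simps)
    have "W t x - utx t x + c * u t x ^ p * (u t x - uxx t x) =
        (c - c / (real p + 1)) * u t x ^ (p + 1) + c / (real p + 1) * u t 0 ^ (p + 1) + G t 0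
          + real p * c * u t x ^ (p - 1) * (ux t x)\<^sup>2 - F t x"
      unfolding utx W_def by (simp add: algebra_simps)
    also have "\<dots> = c / real (p + 1) * u t 0 ^ (p + 1) + G t 0"
      unfolding cB F_def by (simp add: A algebra_simps)
    finally have "W t x - utx t x + c * u t x ^ p * (u t x - uxx t x) = c / real (p + 1) * u t 0 ^ (p + 1) + G t 0" .
    then show "- \<sigma> * (W t x - utx t x) + c * u t x ^ p * (- \<sigma> * (u t x - uxx t x)) =
        - \<sigma> * (c / real (p + 1) * u t 0 ^ (p + 1) + G t 0)"
      by (metis (no_types, opaque_lifting) distrib_left mult.left_commute)
  next
    fix t x y :: real assume t: "t \<in> {0..t1}" and "x \<le> y"
    then show "c * u t x ^ p - c * u t y ^ p \<le> \<bar>c\<bar> * real p * M ^ p * (y - x)"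
      using speed_lipschitz[of t M x y] M[OF t] sub by (auto simp: abs_minus_commute)
  qed (use sub f0 neg xy t1 M0 in auto)
  have "- \<sigma> * (u t1 z - uxx t1 z) \<le> 0" for z
    by (rule DERIV_le_of_right_slopes[OF fx[OF t1]]) (use f_mono in auto)
  then have m: "\<sigma> * (u t1 z - uxx t1 z) \<ge> 0" for z by simp
  have "helmholtz_solution (\<lambda>x. \<sigma> * (u t1 x - uxx t1 x)) (\<lambda>x. \<sigma> * u t1 x)"
    unfolding helmholtz_solution_def
  proof (intro conjI exI allI)
    show "periodic_fun_simple' (\<lambda>x. \<sigma> * u t1 x)" by unfold_locales (simp add: per[OF t1])
    show "((\<lambda>x. \<sigma> * u t1 x) has_real_derivative \<sigma> * ux t1 x) (at x)" for x
      by (rule DERIV_cmult[OF dx[OF t1]])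
    show "((\<lambda>x. \<sigma> * ux t1 x) has_real_derivative \<sigma> * uxx t1 x) (at x)" for x
      by (rule DERIV_cmult[OF dxx[OF t1]])
  qed (simp add: algebra_simps)
  from abs_deriv_helmholtz_le[OF this m, of x] show ?thesis by linarith
qed

end

section \<open>The theorem\<close>

lemma eventually_at_within_in: "\<forall>\<^sub>F r in at t within S. r \<in> S \<and> r \<noteq> t"
  by (simp add: eventually_at_filter)

text \<open>The embedding constant does not depend on the function, so convergence in norm forces
  uniform smallness of the derivatives.\<close>

lemma sobolev_tendsto_uniformly:
  fixes q :: "'a :: t2_space \<Rightarrow> real \<Rightarrow> real"
  assumes r: "r > real j + 1/2" and "i \<le> j" and "e > 0"
    and q: "\<forall>\<^sub>F z in F. continuous_sobolev r (q z)"
    and lim: "((\<lambda>z. sobolev_norm r (q z)) \<longlongrightarrow> 0) F"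
  shows "\<forall>\<^sub>F z in F. \<forall>x. \<bar>(deriv ^^ i) (q z) x\<bar> < e"
proof -
  obtain C where C: "C \<ge> 0"
    "\<And>f i x. continuous_sobolev r f \<Longrightarrow> i \<le> j \<Longrightarrow> \<bar>(deriv ^^ i) f x\<bar> \<le> C * sobolev_norm r f"
    using sobolev_embedding[OF r] by metis
  have "((\<lambda>z. C * sobolev_norm r (q z)) \<longlongrightarrow> C * 0) F" by (intro tendsto_mult lim tendsto_const)
  then have "\<forall>\<^sub>F z in F. C * sobolev_norm r (q z) < e" using \<open>e > 0\<close> by (intro order_tendstoD) auto
  with q show ?thesis
    by eventually_elim (use C(2) \<open>i \<le> j\<close> in \<open>auto intro: le_less_trans\<close>)
qed

lemma continuous_sobolev_differentiable:
  assumes "continuous_sobolev r f" "r > real j + 1/2"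
  shows "i \<le> j \<Longrightarrow> continuous_on UNIV ((deriv ^^ i) f)"
    and "i < j \<Longrightarrow> ((deriv ^^ i) f has_real_derivative (deriv ^^ Suc i) f x) (at x)"
  using sobolev_embedding[OF assms(2)] assms(1) by metis+

lemma deriv_diff_quotient:
  assumes "\<And>x. (f has_real_derivative f' x) (at x)" "\<And>x. (g has_real_derivative g' x) (at x)"
    "\<And>x. (h has_real_derivative h' x) (at x)"
  shows "deriv (\<lambda>x. (f x - g x) / a - h x) x = (f' x - g' x) / a - h' x"
  by (intro DERIV_imp_deriv DERIV_diff DERIV_cdivide assms)

theorem theorem2p3:
  fixes b c s T tstar \<alpha> \<beta> :: real and p :: nat and u :: "real \<Rightarrow> real \<Rightarrow> real"
  assumes "b \<ge> 0" and "c > 0" and "p > 0" and "s > 3/2" and "T > 0"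
    and "is_solution b c p s T u"
    and "(p = 1 \<and> b \<in> {0..3*c} \<and> s > 3/2)
       \<or> (b = real p * c \<and> odd p \<and> s > 3/2)
       \<or> (b = real p * c \<and> even p
            \<and> ((\<forall>x. momentum (u 0) x \<ge> 0) \<or> (\<forall>x. momentum (u 0) x \<le> 0)) \<and> s = 3)"
    and "tstar \<in> {0<..<T}"
    and "\<alpha> \<in> {0..<1}" and "\<beta> \<in> {0..<1}" and "\<alpha> < \<beta>"
    and "\<forall>x\<in>{\<alpha>..\<beta>}. u tstar x = 0"
    and "deriv (\<lambda>t. u t \<alpha>) tstar = 0" and "deriv (\<lambda>t. u t \<beta>) tstar = 0"
  shows "\<forall>t\<in>{0..<T}. \<forall>x. u t x = 0"
proof -
  note b = assms(1) and c = assms(2) and p = assms(3) and s = assms(4) and cases = assms(7)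
  let ?I = "{0..<T}"
  obtain ut where C0u: "C0_sobolev T s u" and cu: "\<And>t. t \<in> ?I \<Longrightarrow> continuous_on UNIV (u t)"
    and C0ut: "C0_sobolev T (s - 1) ut" and cut: "\<And>t. t \<in> ?I \<Longrightarrow> continuous_on UNIV (ut t)"
    and der: "has_sobolev_derivative T (s - 1) u ut"
    and form: "\<And>t. t \<in> ?I \<Longrightarrow> if s > 7/2 then local_form b c p (u t) (ut t) else nonlocal_form b c p (u t) (ut t)"
    using assms(6) unfolding is_solution_def by blast
  have su: "continuous_sobolev s (u t)" if "t \<in> ?I" for t
    using C0u cu that by (intro continuous_sobolevI) (auto simp: C0_sobolev_def)
  have sut: "continuous_sobolev (s - 1) (ut t)" if "t \<in> ?I" for t
    using C0ut cut that by (intro continuous_sobolevI) (auto simp: C0_sobolev_def)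
  have dx: "(u t has_real_derivative deriv (u t) x) (at x)" if "t \<in> ?I" for t x
    using continuous_sobolev_differentiable(2)[OF su[OF that], of 1 0] s by simp
  define q where "q t r x = (u r x - u t x) / (r - t) - ut t x" for t r x
  have sq: "continuous_sobolev (s - 1) (q t r)" if "t \<in> ?I" "r \<in> ?I" for t r
    unfolding q_def[abs_def]
    by (intro continuous_sobolev_diff continuous_sobolev_divide sut that
        continuous_sobolev_mono[OF su, of _ "s - 1"]) simp_all
  \<comment> \<open>Used with j = 0 for the time derivative of u, and with j = 1 when s = 3 for that
    of u_x.\<close>
  have q_small: "\<forall>\<^sub>F r in at t within ?I. \<forall>x. \<bar>(deriv ^^ i) (q t r) x\<bar> < e"
    if t: "t \<in> ?I" and "e > 0" and "i \<le> j" "s - 1 > real j + 1/2" for t e i j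
  proof (rule sobolev_tendsto_uniformly[OF that(4,3,2)])
    show "\<forall>\<^sub>F r in at t within ?I. continuous_sobolev (s - 1) (q t r)"
      using eventually_at_within_in by (rule eventually_mono) (use sq t in blast)
    show "((\<lambda>r. sobolev_norm (s - 1) (q t r)) \<longlongrightarrow> 0) (at t within ?I)"
      using der t unfolding has_sobolev_derivative_def q_def[abs_def] by blast
  qed
  define A where "A = (3 * real p * c - b) / 2"
  define B where "B = b / (real p + 1)"
  have third: "(real p - 1) * (b - real p * c) / 2 = 0" using cases by auto
  \<comment> \<open>For s > 7/2 the equation is given in local form; since s > 3 + 1/2 and s - 1 > 2
    + 1/2, u has three classical space derivatives and u_t has two, which is what the conversion
    needs.\<close>
  have nonlocal: "nonlocal_form b c p (u t) (ut t)" if t: "t \<in> ?I" for t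
  proof (cases "s > 7/2")
    case True
    have "local_form b c p (u t) (ut t) \<longleftrightarrow> nonlocal_form b c p (u t) (ut t)"
    proof (rule local_form_iff_nonlocal_form[OF p])
      show "periodic_fun_simple' (u t)" "periodic_fun_simple' (ut t)"
        using su[OF t] sut[OF t] by (auto simp: continuous_sobolev_def)
      fix x
      note D = continuous_sobolev_differentiable(2)[OF su[OF t], of 3]
        and D' = continuous_sobolev_differentiable(2)[OF sut[OF t], of 2]
      show "(u t has_real_derivative (deriv ^^ Suc 0) (u t) x) (at x)" using D[of 0 x] True by simp
      show "((deriv ^^ Suc 0) (u t) has_real_derivative (deriv ^^ Suc (Suc 0)) (u t) x) (at x)"
        by (rule D) (use True in auto)
      show "((deriv ^^ Suc (Suc 0)) (u t) has_real_derivative (deriv ^^ Suc (Suc (Suc 0))) (u t) x) (at x)"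
        by (rule D) (use True in auto)
      show "(ut t has_real_derivative (deriv ^^ Suc 0) (ut t) x) (at x)" using D'[of 0 x] True by simp
      show "((deriv ^^ Suc 0) (ut t) has_real_derivative (deriv ^^ Suc (Suc 0)) (ut t) x) (at x)"
        by (rule D') (use True in auto)
    qed
    then show ?thesis using form[OF t] True by simp
  qed (use form[OF t] in simp)
  interpret classical_solution c A B T p u "\<lambda>t. deriv (u t)" ut
  proof
    show "p > 0" by (rule p)
    fix t assume t: "t \<in> ?I"
    show "u t (x + 1) = u t x" for x
      using su[OF t] by (simp add: continuous_sobolev_def periodic_fun_simple'_def)
    show "(u t has_real_derivative deriv (u t) x) (at x)" for x by (rule dx[OF t])
    show "continuous_on UNIV (deriv (u t))"
      using continuous_sobolev_differentiable(1)[OF su[OF t], of 1 1] s by simp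
    show "ut t x + c * u t x ^ p * deriv (u t) x =
      - deriv (helmholtz_inverse (\<lambda>y. A * u t y ^ (p - 1) * (deriv (u t) y)\<^sup>2 + B * u t y ^ (p + 1))) x" for x
      using nonlocal[OF t] third unfolding nonlocal_form_def A_def B_def by simp
    fix e :: real assume e: "e > 0"
    show "\<forall>\<^sub>F r in at t within ?I. \<forall>x. \<bar>(u r x - u t x) / (r - t) - ut t x\<bar> < e"
      using q_small[OF t e, of 0 0] s by (simp add: q_def)
    have lim: "((\<lambda>r. sobolev_norm s (\<lambda>x. u r x - u t x)) \<longlongrightarrow> 0) (at t within ?I)"
      using C0u t unfolding C0_sobolev_def by blast
    have sd: "\<forall>\<^sub>F r in at t within ?I. continuous_sobolev s (\<lambda>x. u r x - u t x)"
      using eventually_at_within_in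
      by (rule eventually_mono) (use su t continuous_sobolev_diff in blast)
    have s1: "s > real 1 + 1/2" using s by simp
    show "\<forall>\<^sub>F r in at t within ?I. \<forall>x. \<bar>u r x - u t x\<bar> < e \<and> \<bar>deriv (u r) x - deriv (u t) x\<bar> < e"
      using sobolev_tendsto_uniformly[OF s1 zero_le_one e sd lim]
        sobolev_tendsto_uniformly[OF s1 order_refl e sd lim] eventually_at_within_in
    proof eventually_elim
      case (elim r)
      have "deriv (\<lambda>x. u r x - u t x) x = deriv (u r) x - deriv (u t) x" for x
        using elim(3) t by (intro DERIV_imp_deriv DERIV_diff dx) auto
      then show ?case using elim(1,2) by simp
    qed
  qed
  have tI: "tstar \<in> ?I" using assms(8) by auto
  \<comment> \<open>\<open>ut\<close> is a derivative within [0,T), \<open>deriv\<close> a two-sided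
    one; they agree because \<open>tstar\<close> is an interior time.\<close>
  have ut0: "ut tstar x = 0" if "deriv (\<lambda>t. u t x) tstar = 0" for x
  proof -
    have "((\<lambda>r. u r x) has_real_derivative ut tstar x) (at tstar within {0<..<T})"
      by (rule has_field_derivative_subset[OF dt[OF tI]]) auto
    moreover have "at tstar within {0<..<T} = at tstar"
      by (rule at_within_open[OF assms(8)]) simp
    ultimately have "deriv (\<lambda>r. u r x) tstar = ut tstar x" by (intro DERIV_imp_deriv) (simp only:)
    then show ?thesis using that by simp
  qed
  \<comment> \<open>For odd \<open>p\<close>, including p = 1, the powers p - 1 and p + 1 in F are
    even; for even \<open>p\<close> both are odd, so F has the sign of u.\<close>
  have sign: "(\<forall>x. F tstar x \<ge> 0) \<or> (\<forall>x. F tstar x \<le> 0)"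
  proof (cases "odd p \<or> p = 1")
    case True
    have "A \<ge> 0" "B \<ge> 0" using cases b c p by (auto simp: A_def B_def)
    moreover have "even (p - 1)" "even (p + 1)" using True by auto
    ultimately have "F tstar x \<ge> 0" for x
      unfolding F_def by (intro add_nonneg_nonneg mult_nonneg_nonneg zero_le_even_power) auto
    then show ?thesis by blast
  next
    case False
    then have iii: "b = real p * c" "even p" "s = 3"
      "(\<forall>x. momentum (u 0) x \<ge> 0) \<or> (\<forall>x. momentum (u 0) x \<le> 0)" using cases by auto
    have AB: "A = real p * c" "B = real p * c / (real p + 1)" by (simp_all add: A_def B_def iii(1))
    have AB0: "A \<ge> 0" "B \<ge> 0" using c by (simp_all add: AB)
    have dut: "(ut t has_real_derivative deriv (ut t) x) (at x)" if "t \<in> ?I" for t x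
      using continuous_sobolev_differentiable(2)[OF sut[OF that], of 1 0 x] iii(3) by simp
    obtain \<sigma> :: real where \<sigma>: "\<bar>\<sigma>\<bar> = 1" "\<And>x. \<sigma> * momentum (u 0) x \<ge> 0"
    proof (rule disjE[OF iii(4)])
      assume "\<forall>x. momentum (u 0) x \<ge> 0" then show ?thesis using that[of 1] by simp
    next
      assume "\<forall>x. momentum (u 0) x \<le> 0" then show ?thesis using that[of "-1"] by simp
    qed
    have su0: "\<sigma> * u tstar x \<ge> 0" for x
    proof (rule sign_preserved[OF AB _ _ _ _ tI])
      fix t x assume t: "t \<in> ?I"
      show "(deriv (u t) has_real_derivative (deriv ^^ 2) (u t) x) (at x)"
        using continuous_sobolev_differentiable(2)[OF su[OF t], of 2 1 x] iii(3) by (simp add: numeral_2_eq_2)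
      show "(ut t has_real_derivative deriv (ut t) x) (at x)" by (rule dut[OF t])
      show "((\<lambda>r. deriv (u r) x) has_real_derivative deriv (ut t) x) (at t within ?I)"
      proof (rule has_real_derivative_of_uniform_quotient)
        fix e :: real assume e: "e > 0"
        have "\<forall>\<^sub>F r in at t within ?I. \<forall>x. \<bar>(deriv ^^ 1) (q t r) x\<bar> < e"
          by (rule q_small[OF t e, of 1 1]) (use iii(3) in auto)
        then show "\<forall>\<^sub>F r in at t within ?I. \<bar>(deriv (u r) x - deriv (u t) x) / (r - t) - deriv (ut t) x\<bar> < e"
          using eventually_at_within_in
        proof eventually_elim
          case (elim r)
          have "deriv (q t r) x = (deriv (u r) x - deriv (u t) x) / (r - t) - deriv (ut t) x"
            unfolding q_def[abs_def] using elim(2) t by (intro deriv_diff_quotient dx dut) auto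
          then show ?case using elim(1)[rule_format, of x] by simp
        qed
      qed
    next
      fix x show "\<sigma> * (u 0 x - (deriv ^^ 2) (u 0) x) \<ge> 0" using \<sigma>(2)[of x] by (simp add: momentum_def)
    qed
    have pw: "\<sigma> * u tstar x ^ n \<ge> 0" if "odd n" for n x
    proof -
      have "\<sigma> = 1 \<or> \<sigma> = -1" using \<sigma>(1) by linarith
      then show ?thesis using su0[of x] that by (auto simp: zero_le_odd_power power_le_zero_eq odd_pos)
    qed
    have odd: "odd (p - 1)" "odd (p + 1)" using iii(2) p by auto
    have "\<sigma> * F tstar x \<ge> 0" for x
    proof -
      have "\<sigma> * F tstar x = A * ((\<sigma> * u tstar x ^ (p - 1)) * (deriv (u tstar) x)\<^sup>2) + B * (\<sigma> * u tstar x ^ (p + 1))"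
        unfolding F_def by (simp add: algebra_simps)
      also have "\<dots> \<ge> 0"
        by (intro add_nonneg_nonneg mult_nonneg_nonneg AB0 pw odd) simp
      finally show ?thesis .
    qed
    moreover have "\<sigma> = 1 \<or> \<sigma> = -1" using \<sigma>(1) by linarith
    ultimately show ?thesis by auto
  qed
  have F0: "F tstar x = 0" for x
    by (rule F_eq_0[OF tI sign assms(11)]) (use assms(12) ut0 assms(13,14) in auto)
  have "u tstar x = 0" for x
  \<comment> \<open>With b = 0 the coefficient B vanishes. Then b = pc is impossible as pc > 0, so p
    = 1 and A = 3c/2 > 0: only u_x = 0 is obtained directly, and the constant is read off at
    \<alpha>.\<close>
  proof (cases "b = 0")
    case True
    then have A: "A > 0" "B = 0" "p = 1" using cases c p by (auto simp: A_def B_def)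
    have "A * (deriv (u tstar) x)\<^sup>2 = 0" for x using F0[of x] unfolding F_def by (simp add: A(2,3))
    then have "deriv (u tstar) x = 0" for x using A(1) by simp
    then have "(u tstar has_real_derivative 0) (at x)" for x using dx[OF tI, of x] by simp
    then have "u tstar x = u tstar \<alpha>" by (intro DERIV_isconst_all) blast
    then show ?thesis using assms(11,12) by simp
  next
    case False
    then have B: "B > 0" using b by (simp add: B_def add_pos_nonneg)
    have A: "A \<ge> 0" using cases b c p by (auto simp: A_def)
    \<comment> \<open>F factors into a power of u and a quadratic form with B > 0; either factor
      being zero forces u = 0, the power being 1 when p = 1.\<close>
    have "u tstar x ^ (p - 1) * (A * (deriv (u tstar) x)\<^sup>2 + B * (u tstar x)\<^sup>2) = F tstar x"
      unfolding F_def using p by (cases p) (simp_all add: algebra_simps power2_eq_square)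
    then have "u tstar x ^ (p - 1) = 0 \<or> A * (deriv (u tstar) x)\<^sup>2 + B * (u tstar x)\<^sup>2 = 0"
      using F0[of x] by simp
    moreover have "u tstar x = 0" if "A * (deriv (u tstar) x)\<^sup>2 + B * (u tstar x)\<^sup>2 = 0"
    proof -
      have "B * (u tstar x)\<^sup>2 \<le> 0" using that A by (smt (verit) mult_nonneg_nonneg zero_le_power2)
      then show ?thesis using B by (simp add: mult_le_0_iff)
    qed
    ultimately show ?thesis by auto
  qed
  then show ?thesis using zero_everywhere[OF tI] by blast
qed

end
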